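(* Let $d$ be even and let $c_1<c_2<\cdots<c_u$ ($u\ge0$) be odd positive integers bounded by $d$. Let $H=H_d(c_1,\dots,c_u)$ be the partial $d$-closure $C_d(A(c_1,\dots,c_u,0,1))$ of the ascent algebra $A(c_1,\dots,c_u,0,1)$. Then $H$ is a concave linear Nakayama algebra which is a higher Auslander algebra of global dimension $d$, and $\operatorname{char}(\operatorname{rad}^2P)=(c_1,\dots,c_u)$, where $P$ is the first summit of $H$.
   Context: Conventions: $k$ a field; Nakayama algebras are basic $kQ/I$ with $Q$ a linearly oriented path (linear) or oriented cycle; modules are finitely generated left modules, indecomposables are uniserial; $|M|$ length, $\operatorname{pd}$ projective dimension, $\tau$ Auslander–Reiten translation, $PM$ projective cover. For a linear Nakayama algebra $A$ the simples are $S_1,\dots,S_n$ with $\tau S_i=S_{i-1}$, and $\omega_A=S_n$ is the simple injective. An indecomposable module is even/odd according to the parity of its projective dimension. For indecomposable $M$ with composition factors $F_1=\operatorname{soc}M,\dots,F_m=\operatorname{top}M$ (from bottom to top), $\operatorname{char}M=(z_1,\dots,z_m)$ where $z_i=\operatorname{pd}F_i$ if $F_i$ is odd and $z_i=\operatorname{pd}M$ if $F_i$ is even; $\operatorname{char}0=()$. Height, summits: maximal length of indecomposables, and indecomposables of that length. Concave: Kupisch series $(|PS_1|,\dots,|PS_n|)$ weakly increases then weakly decreases; first summit: the summit $P$ with $\operatorname{rad}P$ projective. Higher Auslander algebra: global dimension equals dominant dimension (dominant dimension = number of initial projective terms in a minimal injective coresolution of ${}_AA$). Ascent algebra: a projective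 characteristic sequence is a finite sequence of non-negative integers with exactly one even entry, this entry being $0$. A linear Nakayama algebra is ascending if its Kupisch series is weakly increasing. For each projective characteristic sequence $\mathbf z$ there is a unique (up to isomorphism) ascending linear Nakayama algebra $A(\mathbf z)$ with $\operatorname{char}P(\omega_{A(\mathbf z)})=\mathbf z$. Partial $d$-closure: a simple $A$-module $S$ is $d$-closed if $S$ is torsionless (a submodule of a projective module) or there is a module $M$ with $\operatorname{soc}M=S$ and $\operatorname{pd}M\ge d$. The $d$-cliff module of $A$ is $Y_A=P(\omega_A)/U$, $U$ the largest submodule of $P(\omega_A)$ all of whose composition factors are $d$-closed. If $Y_A\ne0$, $E_d(A)=A[Y_A]$ is the one-point extension: the linear Nakayama algebra with one more simple $T=\tau^{-}\omega_A$ and $\operatorname{rad}P(T)\cong Y_A$; if $Y_A=0$, $E_d(A)=A$. The partial $d$-closure is $C_d(A)=E_d^t(A)$ for any $t$ such that the $d$-cliff module of $E_d^t(A)$ is zero.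
   Formalization: The even number d is assumed positive; for d = 0 (so u = 0) the claim fails, since C_0(A(0,1)) = A(0,1) has global dimension 1. *)

theory Defs
  imports Main "HOL-Library.Extended_Nat"
begin

text \<open>Combinatorial model of a linear Nakayama algebra.
  An algebra is given by its Kupisch series ks = [|P S_0|, ..., |P S_(n-1)|]
  (simples indexed 0..n-1 instead of 1..n, tau S_i = S_(i-1), omega = S_(n-1)).
  The indecomposable projective P S_b has top S_b and composition factors
  S_b, S_(b-1), ..., S_(b+1-ks!b) (top to socle).
  An indecomposable module is a pair (a,b), a \<le> b, with socle S_a and top S_b
  (composition factors S_a, ..., S_b); zero is None.\<close>

definition kupisch :: "nat list \<Rightarrow> bool" where
  "kupisch ks \<longleftrightarrow> ks \<noteq> [] \<and> ks ! 0 = 1 \<and>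
     (\<forall>i. 0 < i \<and> i < length ks \<longrightarrow> 2 \<le> ks ! i \<and> ks ! i \<le> ks ! (i - 1) + 1)"

definition indec :: "nat list \<Rightarrow> nat \<Rightarrow> nat \<Rightarrow> bool" where
  "indec ks a b \<longleftrightarrow> a \<le> b \<and> b < length ks \<and> b + 1 \<le> a + ks ! b"

definition psoc :: "nat list \<Rightarrow> nat \<Rightarrow> nat" where
  "psoc ks b = b + 1 - ks ! b"

text \<open>projective dimension of the indecomposable (a,b):
  projective iff a = psoc b; otherwise the syzygy is (psoc b, a-1).\<close>
function pd :: "nat list \<Rightarrow> nat \<Rightarrow> nat \<Rightarrow> nat" where
  "pd ks a b = (if a \<le> psoc ks b \<or> b < a then 0 else Suc (pd ks (psoc ks b) (a - 1)))"
  by pat_completeness auto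
termination by (relation "measure (\<lambda>(ks, a, b). b)") auto

definition gldim :: "nat list \<Rightarrow> nat" where
  "gldim ks = Max {pd ks a b | a b. indec ks a b}"

text \<open>the injective envelope of a module with socle S_a is (a, inj_end a)\<close>
definition inj_end :: "nat list \<Rightarrow> nat \<Rightarrow> nat" where
  "inj_end ks a = Max {b. indec ks a b}"

fun cosyz :: "nat list \<Rightarrow> (nat \<times> nat) option \<Rightarrow> (nat \<times> nat) option" where
  "cosyz ks None = None"
| "cosyz ks (Some (a, b)) = (if b = inj_end ks a then None else Some (b + 1, inj_end ks a))"

fun env_proj :: "nat list \<Rightarrow> (nat \<times> nat) option \<Rightarrow> bool" where
  "env_proj ks None = True"
| "env_proj ks (Some (a, b)) = (a = psoc ks (inj_end ks a))"

text \<open>dominant dimension: number of initial projective terms of the minimal injective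
  coresolution of the regular module (sum of all P S_i); the j-th term is the envelope of
  the j-th cosyzygy.\<close>
definition domdim :: "nat list \<Rightarrow> enat" where
  "domdim ks = Sup {enat k | k. \<forall>i < length ks. \<forall>j < k.
      env_proj ks ((cosyz ks ^^ j) (Some (psoc ks i, i)))}"

definition higher_auslander :: "nat list \<Rightarrow> bool" where
  "higher_auslander ks \<longleftrightarrow> enat (gldim ks) = domdim ks"

definition concave :: "nat list \<Rightarrow> bool" where
  "concave ks \<longleftrightarrow> (\<exists>m < length ks.
      (\<forall>i j. i \<le> j \<and> j \<le> m \<longrightarrow> ks ! i \<le> ks ! j) \<and>
      (\<forall>i j. m \<le> i \<and> i \<le> j \<and> j < length ks \<longrightarrow> ks ! j \<le> ks ! i))"

definition ascending :: "nat list \<Rightarrow> bool" where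
  "ascending ks \<longleftrightarrow> (\<forall>i j. i \<le> j \<and> j < length ks \<longrightarrow> ks ! i \<le> ks ! j)"

fun charseq :: "nat list \<Rightarrow> (nat \<times> nat) option \<Rightarrow> nat list" where
  "charseq ks None = []"
| "charseq ks (Some (a, b)) =
     map (\<lambda>i. if odd (pd ks i i) then pd ks i i else pd ks a b) [a..<Suc b]"

definition proj :: "nat list \<Rightarrow> nat \<Rightarrow> (nat \<times> nat) option" where
  "proj ks b = Some (psoc ks b, b)"

fun radpow :: "nat \<Rightarrow> (nat \<times> nat) option \<Rightarrow> (nat \<times> nat) option" where
  "radpow j None = None"
| "radpow j (Some (a, b)) = (if j < b + 1 - a then Some (a, b - j) else None)"

definition omega :: "nat list \<Rightarrow> nat" where
  "omega ks = length ks - 1"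

definition height :: "nat list \<Rightarrow> nat" where
  "height ks = Max (set ks)"

definition first_summit :: "nat list \<Rightarrow> nat \<Rightarrow> bool" where
  "first_summit ks b \<longleftrightarrow> b < length ks \<and> ks ! b = height ks \<and>
     (\<exists>c. c < length ks \<and> radpow 1 (proj ks b) = proj ks c)"

definition d_closed :: "nat \<Rightarrow> nat list \<Rightarrow> nat \<Rightarrow> bool" where
  "d_closed d ks i \<longleftrightarrow> (\<exists>b < length ks. psoc ks b = i) \<or>
     (\<exists>b. indec ks i b \<and> d \<le> pd ks i b)"

text \<open>d-cliff module Y = P(omega)/U, U the largest submodule of P(omega) with all composition
  factors d-closed\<close>
definition cliff :: "nat \<Rightarrow> nat list \<Rightarrow> (nat \<times> nat) option" where
  "cliff d ks = (let s = psoc ks (omega ks) in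
     if \<forall>i. s \<le> i \<and> i \<le> omega ks \<longrightarrow> d_closed d ks i then None
     else Some (LEAST i. s \<le> i \<and> i \<le> omega ks \<and> \<not> d_closed d ks i, omega ks))"

text \<open>one-point extension A[Y]: new simple T with rad P(T) = Y, so |P T| = |Y| + 1\<close>
definition ext_d :: "nat \<Rightarrow> nat list \<Rightarrow> nat list" where
  "ext_d d ks = (case cliff d ks of None \<Rightarrow> ks
                 | Some (a, b) \<Rightarrow> ks @ [b + 1 - a + 1])"

definition closure_terminates :: "nat \<Rightarrow> nat list \<Rightarrow> bool" where
  "closure_terminates d ks \<longleftrightarrow> (\<exists>t. cliff d ((ext_d d ^^ t) ks) = None)"

definition partial_closure :: "nat \<Rightarrow> nat list \<Rightarrow> nat list" where
  "partial_closure d ks = (ext_d d ^^ (LEAST t. cliff d ((ext_d d ^^ t) ks) = None)) ks"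

end

theory Submission
  imports Defs
begin

text \<open>Write an indecomposable module as a half-open interval \<open>[x, y)\<close> and let \<open>f y\<close> be the socle
  of the projective module with top \<open>y - 1\<close>. The syzygies of \<open>[x, y)\<close> are \<open>[f y, x)\<close>, \<open>[f x, f y)\<close>,
  \<open>[f (f y), f x)\<close>, and so on, so projective dimensions are read off from the iterates of \<open>f\<close>.
  With \<open>d = 2m\<close> and \<open>m = k + 1\<close>, a non-torsionless simple \<open>x\<close> of an algebra with \<open>n\<close> simples fails to be
  \<open>d\<close>-closed iff \<open>f^m y\<close> is \<open>f^m x\<close> or \<open>f^(m-1) x\<close> whenever \<open>x \<le> y \<le> n\<close>, and \<open>f (n + 1)\<close> is the
  least such \<open>x\<close>. Hence \<open>f^m\<close> takes only the values \<open>f^(m+1) y\<close> and \<open>f^m y\<close> on \<open>[f y, y]\<close>, which is global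
  dimension at most \<open>d\<close>. The strict increase of the \<open>c\<^sub>i\<close> propagates to all later projectives and
  shows that a non-torsionless simple \<open>x\<close> satisfies \<open>f^m x < f^m (x + 1)\<close>; this forces the socles of the first \<open>d\<close>
  cosyzygies of every projective to be torsionless, hence their envelopes to be projective. The closure terminates because \<open>y - f y\<close> would
  otherwise become constant, and then \<open>f^m\<close> would be injective on a window where it has to repeat a value.\<close>

section \<open>Socle functions, and why their growth must stop\<close>

text \<open>Abstracts a Kupisch series: the projective with top \<open>y - 1\<close> has length
  \<open>y - f y\<close>, and \<open>f_gap\<close> is the bound 2 on all entries after the
  first.\<close>

locale kupisch_fun =
  fixes f :: "nat \<Rightarrow> nat"
  assumes f_mono: "x \<le> y \<Longrightarrow> f x \<le> f y"
    and f_0: "f 0 = 0"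
    and f_1: "f (Suc 0) = 0"
    and f_gap: "2 \<le> y \<Longrightarrow> f y + 2 \<le> y"
begin

lemma f_less: "0 < y \<Longrightarrow> f y < y"
  using f_gap[of y] f_1 by (cases "y = 1") auto

lemma f_le: "f y \<le> y"
  using f_less[of y] f_0 by (cases "y = 0") auto

lemma it_mono: "x \<le> y \<Longrightarrow> (f ^^ j) x \<le> (f ^^ j) y"
  by (induction j) (auto intro: f_mono)

lemma it_Suc: "(f ^^ Suc j) y = (f ^^ j) (f y)"
  by (simp add: funpow_swap1)

lemma it_le: "(f ^^ j) y \<le> y"
  by (induction j) (auto intro: le_trans[OF f_le])

lemma it_antimono: "i \<le> j \<Longrightarrow> (f ^^ j) y \<le> (f ^^ i) y"
  by (metis le_add_diff_inverse2 funpow_add comp_apply it_le)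

lemma it_merge: "(f ^^ i) x = (f ^^ i) y \<Longrightarrow> i \<le> j \<Longrightarrow> (f ^^ j) x = (f ^^ j) y"
  by (metis le_add_diff_inverse2 funpow_add comp_apply)

lemma it_split: "i \<le> j \<Longrightarrow> (f ^^ j) y = (f ^^ (j - i)) ((f ^^ i) y)"
  by (metis le_add_diff_inverse2 funpow_add comp_apply)

end

text \<open>For \<open>f y \<le> x \<le> y\<close> the value \<open>f^(k+1) y\<close> lies between
  \<open>f^(k+1) x\<close> and \<open>f^k x\<close>; lying strictly between them means that
  \<open>[x, y)\<close> has projective dimension at least \<open>2k + 2\<close>. So every candidate
  is required to sit at an endpoint.\<close>

definition unclosed :: "(nat \<Rightarrow> nat) \<Rightarrow> nat \<Rightarrow> nat \<Rightarrow> nat \<Rightarrow> bool" where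
  "unclosed f k n x \<longleftrightarrow> (\<forall>y. x \<le> y \<and> y \<le> n \<longrightarrow>
     (f ^^ Suc k) y = (f ^^ Suc k) x \<or> (f ^^ Suc k) y = (f ^^ k) x)"

text \<open>Records that all values of \<open>f\<close> above \<open>N\<close> come from one-point
  extensions by cliff modules, with the last clause expressing minimality of each new socle.\<close>

definition grown :: "(nat \<Rightarrow> nat) \<Rightarrow> nat \<Rightarrow> nat \<Rightarrow> nat \<Rightarrow> bool" where
  "grown f k N n \<longleftrightarrow> N \<le> n \<and> (\<forall>y. N \<le> y \<and> y < n \<longrightarrow>
     f y < f (Suc y) \<and> unclosed f k y (f (Suc y)) \<and>
     (\<forall>x. f y < x \<and> x < f (Suc y) \<longrightarrow> \<not> unclosed f k y x))"

text \<open>Once \<open>y - f y\<close> is a constant \<open>l \<ge> 2\<close>, \<open>f\<close> and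
  its iterates are translations. The two values allowed at \<open>f (Suc n)\<close> then differ from
  \<open>f^(k+1) n\<close> by \<open>1 - l\<close> and by \<open>1\<close>, so neither is
  taken.\<close>

lemma growth_stops:
  assumes gap: "\<And>y. 2 \<le> y \<Longrightarrow> f y + 2 \<le> y"
    and incr: "\<And>y. N \<le> y \<Longrightarrow> f y < f (Suc y)"
    and uncl: "\<And>y. N \<le> y \<Longrightarrow> unclosed f k y (f (Suc y))"
  shows False
proof -
  \<comment> \<open>The offset 2 makes \<open>gap\<close> applicable even when
    \<open>N = 0\<close>.\<close>
  define P where "P l \<longleftrightarrow> (\<exists>y\<ge>N + 2. y - f y = l)" for l
  define l where "l = (LEAST l. P l)"
  have "P (N + 2 - f (N + 2))" by (auto simp: P_def)
  then have "P l" unfolding l_def by (rule LeastI)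
  then obtain M where M: "M \<ge> N + 2" "M - f M = l" by (auto simp: P_def)
  have const: "y = f y + l" if "M \<le> y" for y
    using that
  proof (induction y rule: dec_induct)
    case base then show ?case using M gap[of M] by auto
  next
    case (step y)
    have "N + 2 \<le> Suc y" using step M by auto
    then have "P (Suc y - f (Suc y))" by (auto simp only: P_def intro!: exI[of _ "Suc y"])
    then have "l \<le> Suc y - f (Suc y)" unfolding l_def by (rule Least_le)
    then show ?case using step incr[of y] gap[of "Suc y"] M by auto
  qed
  have it: "(f ^^ j) y + j * l = y" if "M + j * l \<le> y" for j y
    using that
  proof (induction j)
    case (Suc j)
    then have 1: "(f ^^ j) y + j * l = y" by auto
    then have "M \<le> (f ^^ j) y" using Suc.prems by auto
    then show ?case using const[of "(f ^^ j) y"] 1 by auto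
  qed auto
  \<comment> \<open>Leaves room for \<open>k + 2\<close> translations by \<open>l\<close> before the
    iterates drop below \<open>M\<close>.\<close>
  define n where "n = M + Suc (Suc k) * l"
  have l2: "2 \<le> l" using M gap[of M] by auto
  have "Suc n = f (Suc n) + l" by (rule const) (simp add: n_def)
  then have i: "f (Suc n) = Suc n - l" "f (Suc n) + l = Suc n" by auto
  have "f (Suc n) \<le> n" using l2 i by auto
  moreover have "unclosed f k n (f (Suc n))" using M by (intro uncl) (simp add: n_def)
  ultimately have "(f ^^ Suc k) n = (f ^^ Suc k) (f (Suc n)) \<or> (f ^^ Suc k) n = (f ^^ k) (f (Suc n))"
    unfolding unclosed_def by auto
  moreover have "(f ^^ Suc k) n + Suc k * l = n" by (rule it) (simp add: n_def)
  moreover have "(f ^^ Suc k) (f (Suc n)) + Suc k * l = f (Suc n)"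
    by (rule it) (use i in \<open>simp add: n_def\<close>)
  moreover have "(f ^^ k) (f (Suc n)) + k * l = f (Suc n)"
    by (rule it) (use i in \<open>simp add: n_def\<close>)
  moreover have "Suc k * l = k * l + l" by simp
  ultimately show False using i l2 by linarith
qed

section \<open>Iterates of \<open>f\<close> for an ascent algebra and its extensions\<close>

text \<open>\<open>fN\<close> and \<open>fN1\<close> encode the final entry 1 of the characteristic,
  \<open>even_simple\<close> its entry 0, and \<open>odd_simples\<close> the strict increase of the
  odd entries. \<open>step\<close> is the ascending Kupisch series.\<close>

locale ascent = kupisch_fun +
  fixes N L k :: nat
  assumes N2: "2 \<le> N"
    and fN: "f N = L" and fN1: "f (N - 1) = L"
    and step: "y < N \<Longrightarrow> f (Suc y) \<le> Suc (f y)"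
    and zero: "(f ^^ Suc k) (N - 2) = 0"
    and one: "(f ^^ Suc k) N \<le> 1"
    and even_simple: "0 < (f ^^ j) (N - 2) \<Longrightarrow> (f ^^ Suc j) (N - 2) \<noteq> (f ^^ Suc j) (N - 1)"
    and odd_simples: "L \<le> z \<Longrightarrow> z < x \<Longrightarrow> x < w \<Longrightarrow> w \<le> N - 2 \<Longrightarrow>
       (f ^^ Suc j) x = (f ^^ Suc j) w \<Longrightarrow> (f ^^ j) z = (f ^^ j) x"
begin

text \<open>The bound on global dimension: it empties \<open>[f^(k+1) x, f^(k+1) y)\<close> or
  \<open>[f^(k+2) y, f^(k+1) x)\<close>, two consecutive syzygies of \<open>[x, y)\<close>. Up to
  \<open>N\<close> only the values 0 and 1 occur.\<close>

lemma two_valued: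
  assumes "grown f k N n" "y \<le> n" "f y \<le> x" "x \<le> y"
  shows "(f ^^ Suc k) x = (f ^^ Suc k) (f y) \<or> (f ^^ Suc k) x = (f ^^ Suc k) y"
proof (cases "y \<le> N")
  case True
  have x1: "(f ^^ Suc k) x \<le> (f ^^ Suc k) y" using assms it_mono by blast
  have y1: "(f ^^ Suc k) y \<le> 1" using it_mono[OF True, of "Suc k"] one by linarith
  show ?thesis
  proof (cases "y \<le> N - 2")
    case True
    then have "(f ^^ Suc k) y = 0" using it_mono[of y "N - 2" "Suc k"] zero by auto
    then show ?thesis using x1 by auto
  next
    case False
    with True have "y = N - 1 \<or> y = N" by auto
    then have fy: "f y = L" using fN fN1 by auto
    have "L \<le> N - 2" using fN f_gap[of N] N2 by auto
    then have "(f ^^ Suc k) L = 0" using it_mono[of L "N - 2" "Suc k"] zero by auto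
    then show ?thesis using x1 y1 fy by auto
  qed
next
  case False
  then obtain p where p: "y = Suc p" "N \<le> p" by (cases y) auto
  show ?thesis
  proof (cases "x = y")
    case False
    \<comment> \<open>The socle \<open>f y\<close> was chosen at stage \<open>p\<close>; its second
      permitted value \<open>f^k (f y)\<close> equals \<open>f^(k+1) y\<close>.\<close>
    then have "unclosed f k p (f y)" "x \<le> p" using assms p by (auto simp: grown_def)
    then show ?thesis using assms it_Suc[of k y] unfolding unclosed_def by metis
  qed auto
qed

text \<open>A function rising from 0 by steps of at most 1 skips no value; so the simples up to
  \<open>L\<close> are torsionless.\<close>

lemma surj_N: "x \<le> L \<Longrightarrow> \<exists>y\<le>N. f y = x"
proof -
  assume x: "x \<le> L"
  define y where "y = (LEAST y. x \<le> f y)"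
  have P: "x \<le> f N" using x fN by auto
  then have y: "x \<le> f y" unfolding y_def by (rule LeastI)
  have yN: "y \<le> N" unfolding y_def using P by (rule Least_le)
  have "f y = x"
  proof (cases y)
    case 0 then show ?thesis using y f_0 by auto
  next
    case (Suc p)
    then have "\<not> x \<le> f p" using not_less_Least[of p "\<lambda>y. x \<le> f y"] y_def by auto
    then show ?thesis using step[of p] y Suc yN by auto
  qed
  then show ?thesis using yN by auto
qed

text \<open>Read with merging times: within a projective, the exponents at which neighbouring
  points get identified by the iterates of f increase strictly along each run.\<close>

lemma merging_times:
  assumes "grown f k N n" "L \<le> p" "p \<le> n" "f p \<le> z" "z < x" "x < w" "w \<le> p"
    "0 < (f ^^ j) z" "(f ^^ Suc j) z = (f ^^ Suc j) x" "(f ^^ Suc j) x = (f ^^ Suc j) w"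
  shows "(f ^^ j) z = (f ^^ j) x"
  using assms(2-)
proof (induction p arbitrary: z x w j rule: less_induct)
  case (less p)
  note prems = less.prems
  \<comment> \<open>The case inside \<open>[L, N]\<close>. If \<open>w\<close> exceeds
    \<open>N - 2\<close>, then \<open>N - 2\<close> and \<open>N - 1\<close> are squeezed between
    \<open>z\<close> and \<open>w\<close> and merge too, which \<open>even_simple\<close>
    forbids.\<close>
  have base: "(f ^^ j) z = (f ^^ j) x" if "L \<le> z" "z < x" "x < w" "w \<le> N"
    "0 < (f ^^ j) z" "(f ^^ Suc j) z = (f ^^ Suc j) x" "(f ^^ Suc j) x = (f ^^ Suc j) w" for z x w j
  proof (cases "w \<le> N - 2")
    case True then show ?thesis using odd_simples that by blast
  next
    case False
    have z: "z \<le> N - 2" using that by auto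
    have "0 < (f ^^ j) (N - 2)" using it_mono[OF z, of j] that by linarith
    then have ne: "(f ^^ Suc j) (N - 2) \<noteq> (f ^^ Suc j) (N - 1)" by (rule even_simple)
    have "(f ^^ Suc j) z \<le> (f ^^ Suc j) (N - 2)" by (rule it_mono[OF z])
    moreover have "(f ^^ Suc j) (N - 1) \<le> (f ^^ Suc j) w" using False by (intro it_mono) auto
    moreover have "(f ^^ Suc j) (N - 2) \<le> (f ^^ Suc j) (N - 1)" by (intro it_mono) auto
    ultimately show ?thesis using ne that by linarith
  qed
  show ?case
  proof (cases "p \<le> N")
    case True
    show ?thesis
    proof (cases "L \<le> z")
      case True then show ?thesis using base[of z x w j] prems \<open>p \<le> N\<close> by auto
    next
      case False
      have LN: "L \<le> N" using fN f_le[of N] by auto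
      have fLz: "f L \<le> z" using f_mono[OF prems(1)] prems by auto
      obtain z0 where z0: "z0 \<le> N" "f z0 = z" using surj_N[of z] False by auto
      \<comment> \<open>Points below \<open>L\<close> are pulled back along \<open>f\<close> into
        \<open>[L, N]\<close>, to use \<open>base\<close> with exponent \<open>j + 1\<close>. The
        maximum does not change the image, because \<open>f L \<le> z\<close>.\<close>
      define z' where "z' = max L z0"
      have z': "z' \<le> N" "f z' = z" and Lz: "L \<le> z'"
        using z0 LN fLz f_mono[of z0 L] by (auto simp: z'_def max_def)
      have z'2: "z' \<le> N - 2"
        using z' False fN1 f_mono[of "N - 1" z'] by (cases "N - 1 \<le> z'") auto
      have zz: "z \<le> f (N - 2)" using f_mono[OF z'2] z' by auto
      show ?thesis
      proof (cases "w \<le> L")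
        case True
        obtain x' where x': "x' \<le> N" "f x' = x" using surj_N[of x] prems True by auto
        have wN: "w \<le> f (N - 1)" using True fN1 by auto
        define w' where "w' = (LEAST v. w \<le> f v)"
        have w'1: "w \<le> f w'" unfolding w'_def using wN by (rule LeastI)
        have w'2: "w' \<le> N - 1" unfolding w'_def using wN by (rule Least_le)
        obtain w0 where w0: "w0 \<le> N" "f w0 = w" using surj_N[OF True] by auto
        have "w' \<le> w0" unfolding w'_def using w0 by (intro Least_le) auto
        then have fw': "f w' = w" using f_mono[of w' w0] w0 w'1 by auto
        have ord: "z' < x'" "x' < w'" using f_mono prems z' x' fw' by (meson not_le leD)+
        have "(f ^^ Suc j) z' = (f ^^ Suc j) x'"
          by (rule base[of z' x' w'])
            (use Lz ord w'2 prems z' x' fw' in \<open>auto simp: it_Suc simp del: funpow.simps\<close>)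
        then show ?thesis using z' x' by (simp add: it_Suc del: funpow.simps)
      next
        case False
        \<comment> \<open>Now \<open>L\<close> lies between \<open>z\<close> and \<open>w\<close>,
          hence merges with \<open>z\<close>. This traps the images of \<open>N - 2\<close> and
          \<open>N - 1\<close> at one value, against \<open>even_simple\<close>.\<close>
        have "(f ^^ Suc j) z \<le> (f ^^ Suc j) L" using \<open>\<not> L \<le> z\<close> by (intro it_mono) auto
        moreover have "(f ^^ Suc j) L \<le> (f ^^ Suc j) w" using False by (intro it_mono) auto
        ultimately have zL: "(f ^^ Suc j) z = (f ^^ Suc j) L" using prems by linarith
        have 1: "0 < (f ^^ Suc j) (N - 2)"
          using it_mono[OF zz, of j] prems by (simp add: it_Suc del: funpow.simps)
        have "(f ^^ Suc j) z \<le> (f ^^ Suc (Suc j)) (N - 2)"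
          using it_mono[OF zz, of "Suc j"] by (simp add: it_Suc[of "Suc j"] del: funpow.simps)
        moreover have "(f ^^ Suc (Suc j)) (N - 2) \<le> (f ^^ Suc (Suc j)) (N - 1)" by (intro it_mono) auto
        moreover have "(f ^^ Suc (Suc j)) (N - 1) = (f ^^ Suc j) L"
          using fN1 by (simp add: it_Suc[of "Suc j"] del: funpow.simps)
        ultimately show ?thesis using even_simple[OF 1] zL by linarith
      qed
    qed
  next
    case False
    then obtain q where q: "p = Suc q" "N \<le> q" by (cases p) auto
    have fq: "f q < f p" using assms(1) prems q by (auto simp: grown_def)
    have Lq: "L \<le> f q" using f_mono[OF q(2)] fN by auto
    have Nq: "L \<le> q" using Lq f_le[of q] by auto
    show ?thesis
    proof (cases "w \<le> q")
      case True
      then show ?thesis using less.IH[of q z x w j] prems q fq Nq by auto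
    next
      case False
      then have w: "w = p" using prems q by auto
      \<comment> \<open>With \<open>w = p\<close> the images of \<open>x\<close> and
        \<open>w\<close> still differ, so \<open>j > 0\<close>. One application of \<open>f\<close>
        moves all three points into the smaller projective ending at \<open>f p\<close>.\<close>
      have fx: "f x < f p" using f_mono[of x q] prems q w fq by auto
      show ?thesis
      proof (cases j)
        case 0 then show ?thesis using prems fx w by auto
      next
        case (Suc i)
        show ?thesis
        proof (cases "f z = f x")
          case True
          then show ?thesis using Suc by (simp add: it_Suc del: funpow.simps)
        next
          case False
          then have "f z < f x" using f_mono[of z x] prems by auto
          then have "(f ^^ i) (f z) = (f ^^ i) (f x)"
            using prems fx w Suc Lq fq
            by (intro less.IH[of z "f z" "f x" "f p" i])
              (auto simp: it_Suc[of "Suc _"] it_Suc simp del: funpow.simps)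
          then show ?thesis using Suc by (simp add: it_Suc del: funpow.simps)
        qed
      qed
    qed
  qed
qed

text \<open>The witness \<open>y\<close> gives a module \<open>[x, y)\<close> of projective
  dimension at least \<open>2k + 2\<close>. If \<open>f^(k+1)\<close> identified \<open>x\<close>
  and \<open>Suc x\<close>, then \<open>merging_times\<close> applied to \<open>f n\<close>,
  \<open>x\<close>, \<open>Suc x\<close> would give \<open>f^k x = f^(k+1) n\<close>, leaving no
  room for that dimension.\<close>

lemma closed_imp_split:
  assumes g: "grown f k N n" and x: "f n < x" "x < n" and "\<not> unclosed f k n x"
  shows "(f ^^ Suc k) x < (f ^^ Suc k) (Suc x) \<and>
    (\<exists>y\<le>n. x < y \<and> f y \<le> x \<and> (f ^^ Suc k) x < (f ^^ Suc k) y \<and> (f ^^ Suc k) y < (f ^^ k) x)"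
proof -
  obtain y where y: "x \<le> y" "y \<le> n" "(f ^^ Suc k) y \<noteq> (f ^^ Suc k) x" "(f ^^ Suc k) y \<noteq> (f ^^ k) x"
    using assms(4) by (auto simp: unclosed_def)
  have xy: "x < y" using y by (cases "x = y") auto
  have lt: "(f ^^ Suc k) x < (f ^^ Suc k) y" using it_mono[OF y(1), of "Suc k"] y(3) by linarith
  have yn: "(f ^^ Suc k) y \<le> (f ^^ Suc k) n" using y by (intro it_mono)
  have nx: "(f ^^ Suc k) n \<le> (f ^^ k) x"
    using it_mono[of "f n" x k] x by (simp add: it_Suc del: funpow.simps)
  have lt2: "(f ^^ Suc k) y < (f ^^ k) x" using yn nx y by linarith
  have fy: "f y \<le> x" using f_mono[OF y(2)] x by auto
  have "(f ^^ Suc k) x < (f ^^ Suc k) (Suc x)"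
  proof (rule ccontr)
    assume "\<not> ?thesis"
    then have eq: "(f ^^ Suc k) x = (f ^^ Suc k) (Suc x)" using it_mono[of x "Suc x" "Suc k"] by linarith
    \<comment> \<open>Only two values occur on \<open>[f n, n]\<close>: \<open>x\<close> takes the
      lower one and \<open>y\<close> the upper one.\<close>
    have tx: "(f ^^ Suc k) x = (f ^^ Suc k) (f n)" using two_valued[OF g, of n x] x lt yn by auto
    have ty: "(f ^^ Suc k) y = (f ^^ Suc k) n" using two_valued[OF g, of n y] x y lt tx by auto
    have Ln: "L \<le> n" using g f_mono[of N n] fN f_le[of n] by (auto simp: grown_def)
    have "(f ^^ k) (f n) = (f ^^ k) x"
      by (rule merging_times[OF g Ln, of "f n" x "Suc x"])
        (use x tx eq lt ty in \<open>auto simp: it_Suc[of k n] simp del: funpow.simps\<close>)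
    then show False using lt2 ty by (simp add: it_Suc del: funpow.simps)
  qed
  then show ?thesis using y xy lt lt2 fy by blast
qed

text \<open>A simple between \<open>L\<close> and \<open>f n\<close> that is no socle was jumped
  over at some stage \<open>q\<close>. It was closed then, and the witness found at stage
  \<open>q\<close> is still available at stage \<open>n\<close>.\<close>

lemma torsionless_or_split:
  assumes g: "grown f k N n" and closed: "\<And>x. f n < x \<Longrightarrow> x < n \<Longrightarrow> \<not> unclosed f k n x"
    and x: "x < n"
  shows "x \<in> f ` {..n} \<or> (f ^^ Suc k) x < (f ^^ Suc k) (Suc x) \<and>
    (\<exists>y\<le>n. x < y \<and> f y \<le> x \<and> (f ^^ Suc k) x < (f ^^ Suc k) y \<and> (f ^^ Suc k) y < (f ^^ k) x)"
proof -
  have Nn: "N \<le> n" using g by (auto simp: grown_def)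
  consider "x \<le> L" | "L < x" "x \<le> f n" | "f n < x" by linarith
  then show ?thesis
  proof cases
    case 1
    then obtain y where "y \<le> N" "f y = x" using surj_N by blast
    then show ?thesis using Nn by auto
  next
    case 2
    define p where "p = (LEAST p. x \<le> f p)"
    have p: "x \<le> f p" unfolding p_def using 2(2) by (rule LeastI)
    have pn: "p \<le> n" unfolding p_def using 2(2) by (rule Least_le)
    have pN: "N < p" using p 2 f_mono[of p N] fN by (cases "N < p") auto
    then obtain q where q: "p = Suc q" "N \<le> q" by (cases p) auto
    have fq: "f q < x" using not_less_Least[of q "\<lambda>p. x \<le> f p"] q p_def by auto
    have gq: "grown f k N q" using g q pn by (auto simp: grown_def)
    show ?thesis
    proof (cases "x = f p")
      case True then show ?thesis using pn by auto
    next
      case False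
      then have "\<not> unclosed f k q x" using g p q fq pn by (auto simp: grown_def)
      moreover have "x < q" using p q N2 f_gap[of p] by auto
      ultimately have "(f ^^ Suc k) x < (f ^^ Suc k) (Suc x) \<and>
        (\<exists>y\<le>q. x < y \<and> f y \<le> x \<and> (f ^^ Suc k) x < (f ^^ Suc k) y \<and> (f ^^ Suc k) y < (f ^^ k) x)"
        using closed_imp_split[OF gq fq] by blast
      moreover have "q \<le> n" using q pn by auto
      ultimately show ?thesis by (meson le_trans)
    qed
  next
    case 3
    then show ?thesis using closed_imp_split[OF g 3 x closed[OF 3 x]] by blast
  qed
qed

text \<open>The interval \<open>[a, b)\<close> is meant to be an iterated cosyzygy of the projective module \<open>[f y, y)\<close>;
  the disjunction is over the parity of the number of steps taken.\<close>

lemma cosyzygy_torsionless: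
  assumes g: "grown f k N n" and closed: "\<And>x. f n < x \<Longrightarrow> x < n \<Longrightarrow> \<not> unclosed f k n x"
    and ab: "a < b" "b \<le> n" "f b \<le> a" and i: "i \<le> k"
    and orig: "(f ^^ i) a = f y \<and> (f ^^ i) b = y \<or> (f ^^ i) a = y \<and> (f ^^ Suc i) b = f y"
  shows "a \<in> f ` {..n}"
proof (rule ccontr)
  assume a: "a \<notin> f ` {..n}"
  have "a < n" using ab by simp
  from torsionless_or_split[OF g closed this] a obtain w where lt: "(f ^^ Suc k) a < (f ^^ Suc k) (Suc a)"
    and w: "w \<le> n" "a < w" "f w \<le> a" "(f ^^ Suc k) a < (f ^^ Suc k) w" "(f ^^ Suc k) w < (f ^^ k) a"
    by blast
  from orig show False
  proof
    assume *: "(f ^^ i) a = f y \<and> (f ^^ i) b = y"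
    then have "(f ^^ i) a = (f ^^ i) (f b)" by (simp add: funpow_swap1[symmetric])
    \<comment> \<open>Even number of steps: the witness \<open>w\<close> lies inside
      \<open>[a, b)\<close>, but its value would be a third one beside those allowed by
      \<open>two_valued\<close> at \<open>b\<close>.\<close>
    from it_merge[OF this i] have eq: "(f ^^ k) a = (f ^^ Suc k) b" by (simp only: it_Suc)
    have "w < b" using eq w it_mono[of b w "Suc k"] by (cases "w < b") auto
    then have "(f ^^ Suc k) w = (f ^^ Suc k) (f b) \<or> (f ^^ Suc k) w = (f ^^ Suc k) b"
      using two_valued[OF g, of b w] ab w by auto
    moreover have "(f ^^ Suc k) (f b) \<le> (f ^^ Suc k) a" using ab by (intro it_mono)
    ultimately show False using w eq by linarith
  next
    assume *: "(f ^^ i) a = y \<and> (f ^^ Suc i) b = f y"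
    \<comment> \<open>Odd number of steps: \<open>a\<close> and \<open>b\<close> merge, hence so do
      \<open>a\<close> and \<open>Suc a\<close>, contrary to the split at \<open>a\<close>.\<close>
    then have "(f ^^ Suc i) a = (f ^^ Suc i) b" by simp
    from it_merge[OF this, of "Suc k"] have "(f ^^ Suc k) a = (f ^^ Suc k) b" using i by blast
    moreover have "(f ^^ Suc k) (Suc a) \<le> (f ^^ Suc k) b" using ab by (intro it_mono) auto
    ultimately show False using lt by linarith
  qed
qed

end

section \<open>Projective dimension and cliff modules in terms of socle functions\<close>

text \<open>Half-open form of \<open>psoc\<close>. The minimum extends it constantly beyond the
  algebra, and truncated subtraction gives the value 0 at 0 for a Kupisch series.\<close>

definition lo :: "nat list \<Rightarrow> nat \<Rightarrow> nat" where
  "lo ks y = psoc ks (min y (length ks) - 1)"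

lemma lo_psoc: "b < length ks \<Longrightarrow> lo ks (Suc b) = psoc ks b"
  by (simp add: lo_def min_def)

lemma kupisch_bounds:
  assumes "kupisch ks" "b < length ks"
  shows "1 \<le> ks ! b \<and> ks ! b \<le> Suc b"
  using assms(2)
proof (induction b)
  case 0 then show ?case using assms by (auto simp: kupisch_def)
next
  case (Suc b)
  then have "2 \<le> ks ! Suc b \<and> ks ! Suc b \<le> ks ! b + 1" using assms(1)
    by (auto simp: kupisch_def dest!: spec[of _ "Suc b"])
  then show ?case using Suc by auto
qed

lemma kupisch_lo:
  assumes "kupisch ks"
  shows "kupisch_fun (lo ks)"
proof
  have Suc: "lo ks y \<le> lo ks (Suc y)" for y
  proof (cases "0 < y \<and> y < length ks")
    case True
    then have "ks ! y \<le> ks ! (y - 1) + 1" using assms by (auto simp: kupisch_def)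
    then show ?thesis using True kupisch_bounds[OF assms, of "y - 1"] by (auto simp: lo_def psoc_def min_def)
  next
    case False
    then have "y = 0 \<or> length ks \<le> y" by auto
    then show ?thesis using assms by (auto simp: lo_def min_def kupisch_def psoc_def)
  qed
  show "x \<le> y \<Longrightarrow> lo ks x \<le> lo ks y" for x y
    by (rule lift_Suc_mono_le[of "lo ks"]) (use Suc in auto)
  have "ks \<noteq> []" "ks ! 0 = 1" using assms by (auto simp: kupisch_def)
  then show "lo ks 0 = 0" "lo ks (Suc 0) = 0"
    by (auto simp: lo_def psoc_def min_def Suc_le_eq)
  show "lo ks y + 2 \<le> y" if "2 \<le> y" for y
  proof (cases "length ks = 1")
    case True
    then show ?thesis using that \<open>ks ! 0 = 1\<close> by (auto simp: lo_def psoc_def)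
  next
    case False
    then have len: "2 \<le> length ks" using \<open>ks \<noteq> []\<close> by (cases ks) (auto simp: Suc_le_eq)
    define b where "b = min y (length ks) - 1"
    have b: "0 < b" "b < length ks" "Suc b \<le> y" using len that by (auto simp: b_def)
    have "2 \<le> ks ! b" using assms b by (auto simp: kupisch_def)
    moreover have "ks ! b \<le> Suc b" using kupisch_bounds[OF assms b(2)] by auto
    moreover have "lo ks y = b + 1 - ks ! b" by (simp only: lo_def psoc_def b_def)
    ultimately show ?thesis using b by linarith
  qed
qed

declare pd.simps [simp del]

lemma pd_rec:
  assumes "x < y" "y \<le> length ks"
  shows "pd ks x (y - 1) = (if x \<le> lo ks y then 0 else Suc (pd ks (lo ks y) (x - 1)))"
proof -
  have "lo ks y = psoc ks (y - 1)" using assms by (simp add: lo_def min_def)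
  then show ?thesis using assms by (subst pd.simps) auto
qed

context
  fixes ks :: "nat list"
  assumes kup: "kupisch ks"
begin

interpretation kupisch_fun "lo ks"
  by (rule kupisch_lo[OF kup])

text \<open>Taking two syzygies applies \<open>f\<close> to both endpoints, which is what makes
  projective dimension a matter of iterates.\<close>

lemma pd_rec2:
  assumes "x < y" "y \<le> length ks"
  shows "pd ks x (y - 1) = (if x \<le> lo ks y then 0 else if lo ks y \<le> lo ks x then 1
    else Suc (Suc (pd ks (lo ks x) (lo ks y - 1))))"
  using pd_rec[OF assms] pd_rec[of "lo ks y" x] assms by auto

text \<open>The inequalities say that the syzygies \<open>2j + 1\<close> and \<open>2j\<close> are
  non-empty intervals. Earlier ones are then non-empty as well, since by monotonicity an endpoint
  coincidence would persist.\<close>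

lemma pd_ge_odd:
  assumes "x < y" "y \<le> length ks" "lo ks y \<le> x"
  shows "2 * j + 1 \<le> pd ks x (y - 1) \<longleftrightarrow>
    (lo ks ^^ Suc j) y < (lo ks ^^ j) x \<and> (lo ks ^^ j) x < (lo ks ^^ j) y"
  using assms
proof (induction j arbitrary: x y)
  case 0
  then show ?case by (subst pd_rec2) auto
next
  case (Suc j)
  have m: "lo ks (lo ks y) \<le> lo ks x" using Suc by (intro f_mono)
  show ?case
  proof (cases "lo ks y < x \<and> lo ks x < lo ks y")
    case True
    have "lo ks y \<le> length ks" using f_le[of y] Suc by auto
    then have "2 * j + 1 \<le> pd ks (lo ks x) (lo ks y - 1) \<longleftrightarrow>
      (lo ks ^^ Suc j) (lo ks y) < (lo ks ^^ j) (lo ks x) \<and> (lo ks ^^ j) (lo ks x) < (lo ks ^^ j) (lo ks y)"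
      using Suc True m by blast
    moreover have "2 * Suc j + 1 \<le> pd ks x (y - 1) \<longleftrightarrow> 2 * j + 1 \<le> pd ks (lo ks x) (lo ks y - 1)"
      using Suc.prems True by (subst pd_rec2) auto
    ultimately show ?thesis by (simp only: it_Suc)
  next
    case False
    then have "\<not> 2 * Suc j + 1 \<le> pd ks x (y - 1)" using Suc.prems by (subst pd_rec2) auto
    moreover have "x \<le> lo ks y \<Longrightarrow> (lo ks ^^ Suc j) x \<le> (lo ks ^^ Suc j) (lo ks y)" by (rule it_mono)
    moreover have "lo ks y \<le> lo ks x \<Longrightarrow> (lo ks ^^ j) (lo ks y) \<le> (lo ks ^^ j) (lo ks x)" by (rule it_mono)
    ultimately show ?thesis using False unfolding it_Suc by linarith
  qed
qed

lemma pd_ge_even: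
  assumes "x < y" "y \<le> length ks" "lo ks y \<le> x"
  shows "2 * Suc j \<le> pd ks x (y - 1) \<longleftrightarrow>
    (lo ks ^^ Suc j) x < (lo ks ^^ Suc j) y \<and> (lo ks ^^ Suc j) y < (lo ks ^^ j) x"
  using assms
proof (induction j arbitrary: x y)
  case 0
  then show ?case by (subst pd_rec2) auto
next
  case (Suc j)
  have m: "lo ks (lo ks y) \<le> lo ks x" using Suc by (intro f_mono)
  show ?case
  proof (cases "lo ks y < x \<and> lo ks x < lo ks y")
    case True
    have "lo ks y \<le> length ks" using f_le[of y] Suc by auto
    then have "2 * Suc j \<le> pd ks (lo ks x) (lo ks y - 1) \<longleftrightarrow>
      (lo ks ^^ Suc j) (lo ks x) < (lo ks ^^ Suc j) (lo ks y) \<and>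
      (lo ks ^^ Suc j) (lo ks y) < (lo ks ^^ j) (lo ks x)"
      using Suc True m by blast
    moreover have "2 * Suc (Suc j) \<le> pd ks x (y - 1) \<longleftrightarrow> 2 * Suc j \<le> pd ks (lo ks x) (lo ks y - 1)"
      using Suc.prems True by (subst pd_rec2) auto
    ultimately show ?thesis by (simp only: it_Suc)
  next
    case False
    then have "\<not> 2 * Suc (Suc j) \<le> pd ks x (y - 1)" using Suc.prems by (subst pd_rec2) auto
    moreover have "x \<le> lo ks y \<Longrightarrow> (lo ks ^^ Suc j) x \<le> (lo ks ^^ Suc j) (lo ks y)" by (rule it_mono)
    moreover have "lo ks y \<le> lo ks x \<Longrightarrow> (lo ks ^^ Suc j) (lo ks y) \<le> (lo ks ^^ Suc j) (lo ks x)" by (rule it_mono)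
    ultimately show ?thesis using False unfolding it_Suc by linarith
  qed
qed

lemma indec_lo: "x < y \<Longrightarrow> indec ks x (y - 1) \<longleftrightarrow> y \<le> length ks \<and> lo ks y \<le> x"
  by (auto simp: indec_def lo_def psoc_def min_def)

text \<open>Above the socle of the last projective no simple is torsionless, so only the dimension
  clause counts. Monotonicity already gives the weak inequalities of
  \<open>pd_ge_even\<close>.\<close>

lemma d_closed_iff:
  assumes x: "lo ks (length ks) < x" "x < length ks"
  shows "d_closed (2 * Suc k) ks x \<longleftrightarrow> \<not> unclosed (lo ks) k (length ks) x"
proof -
  let ?F = "lo ks" and ?n = "length ks"
  have "\<not> (\<exists>b<?n. psoc ks b = x)"
  proof
    assume "\<exists>b<?n. psoc ks b = x"
    then obtain b where b: "b < ?n" "psoc ks b = x" by blast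
    then show False using f_mono[of "Suc b" ?n] x lo_psoc[of b ks] by linarith
  qed
  then have "d_closed (2 * Suc k) ks x \<longleftrightarrow> (\<exists>b. indec ks x b \<and> 2 * Suc k \<le> pd ks x b)"
    unfolding d_closed_def by blast
  also have "\<dots> \<longleftrightarrow> \<not> unclosed ?F k ?n x"
  proof
    assume "\<exists>b. indec ks x b \<and> 2 * Suc k \<le> pd ks x b"
    then obtain b where b: "indec ks x b" "2 * Suc k \<le> pd ks x b" by blast
    have x: "x < Suc b" using b by (simp add: indec_def)
    have y: "Suc b \<le> ?n" "?F (Suc b) \<le> x" using indec_lo[OF x] b by simp_all
    have "(?F ^^ Suc k) x < (?F ^^ Suc k) (Suc b) \<and> (?F ^^ Suc k) (Suc b) < (?F ^^ k) x"
      using pd_ge_even[OF x y, of k] b(2) by simp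
    then show "\<not> unclosed ?F k ?n x"
      unfolding unclosed_def using x y(1) by (metis less_imp_le_nat nat_neq_iff)
  next
    assume "\<not> unclosed ?F k ?n x"
    then obtain y where y: "x \<le> y" "y \<le> ?n" "(?F ^^ Suc k) y \<noteq> (?F ^^ Suc k) x"
      "(?F ^^ Suc k) y \<noteq> (?F ^^ k) x"
      unfolding unclosed_def by blast
    have fy: "?F y \<le> x" using f_mono[OF y(2)] x by linarith
    have "(?F ^^ Suc k) y \<le> (?F ^^ k) x" using it_mono[OF fy, of k] by (simp only: it_Suc)
    moreover have "(?F ^^ Suc k) x \<le> (?F ^^ Suc k) y" using y(1) by (rule it_mono)
    moreover have xy: "x < y" using y(1,3) by (cases "x = y") simp_all
    ultimately have "2 * Suc k \<le> pd ks x (y - 1)"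
      using pd_ge_even[OF xy y(2) fy, of k] y(3,4) by linarith
    moreover have "indec ks x (y - 1)" using indec_lo[OF xy] y(2) fy by blast
    ultimately show "\<exists>b. indec ks x b \<and> 2 * Suc k \<le> pd ks x b" by blast
  qed
  finally show ?thesis .
qed

lemma d_closed_psoc: "d_closed d ks (lo ks (length ks))"
proof -
  have "ks \<noteq> []" using kup by (auto simp: kupisch_def)
  then show ?thesis
    by (auto simp: d_closed_def lo_def intro!: exI[of _ "length ks - 1"])
qed

lemma cliff_None:
  "cliff (2 * Suc k) ks = None \<longleftrightarrow>
    (\<forall>x. lo ks (length ks) < x \<and> x < length ks \<longrightarrow> \<not> unclosed (lo ks) k (length ks) x)"
proof -
  have ne: "ks \<noteq> []" using kup by (auto simp: kupisch_def)
  have "cliff (2 * Suc k) ks = None \<longleftrightarrow>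
    (\<forall>x. lo ks (length ks) \<le> x \<and> x < length ks \<longrightarrow> d_closed (2 * Suc k) ks x)"
    using ne by (cases ks) (auto simp: cliff_def Let_def omega_def lo_def less_Suc_eq_le)
  also have "\<dots> \<longleftrightarrow> (\<forall>x. lo ks (length ks) < x \<and> x < length ks \<longrightarrow> d_closed (2 * Suc k) ks x)"
    using d_closed_psoc[of "2 * Suc k"] by (auto simp: le_less)
  also have "\<dots> \<longleftrightarrow>
    (\<forall>x. lo ks (length ks) < x \<and> x < length ks \<longrightarrow> \<not> unclosed (lo ks) k (length ks) x)"
    using d_closed_iff by blast
  finally show ?thesis .
qed

text \<open>The submodule \<open>U\<close> ends just below the first simple that is not closed, so
  the cliff module is \<open>[a, length ks)\<close>. The socle of the last projective is
  torsionless, whence \<open>a\<close> lies strictly above it.\<close>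

lemma cliff_Some:
  assumes "cliff (2 * Suc k) ks \<noteq> None"
  obtains a where "cliff (2 * Suc k) ks = Some (a, length ks - 1)" "lo ks (length ks) < a"
    "a < length ks" "unclosed (lo ks) k (length ks) a"
    "\<And>x. lo ks (length ks) < x \<Longrightarrow> x < a \<Longrightarrow> \<not> unclosed (lo ks) k (length ks) x"
proof -
  have ne: "ks \<noteq> []" using kup by (auto simp: kupisch_def)
  let ?P = "\<lambda>i. lo ks (length ks) \<le> i \<and> i \<le> length ks - 1 \<and> \<not> d_closed (2 * Suc k) ks i"
  define a where "a = (LEAST i. ?P i)"
  have c: "cliff (2 * Suc k) ks = Some (a, length ks - 1)"
    using assms ne by (auto simp: a_def cliff_def Let_def omega_def lo_def split: if_splits)
  obtain x where x: "lo ks (length ks) < x" "x < length ks" "unclosed (lo ks) k (length ks) x"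
    using assms unfolding cliff_None by blast
  then have "\<not> d_closed (2 * Suc k) ks x" using d_closed_iff[OF x(1,2), of k] by blast
  with x have "?P x" by simp
  then have a: "?P a" unfolding a_def by (rule LeastI)
  have a1: "lo ks (length ks) < a" using a d_closed_psoc by (cases "a = lo ks (length ks)") auto
  have a2: "a < length ks" using a ne by (cases ks) auto
  have "\<not> unclosed (lo ks) k (length ks) x" if "lo ks (length ks) < x" "x < a" for x
    
  proof -
    have "\<not> ?P x" using not_less_Least[of x ?P] that unfolding a_def by blast
    then show ?thesis using that a2 d_closed_iff[of x k] by linarith
  qed
  then show ?thesis using that[OF c a1 a2] a d_closed_iff[OF a1 a2, of k] by blast
qed

end

section \<open>Global and dominant dimension once the cliff module vanishes\<close>

locale closed_algebra = ascent "lo ks" N L k for ks N L k +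
  assumes kup: "kupisch ks"
    and grown: "grown (lo ks) k N (length ks)"
    and closed: "\<And>x. lo ks (length ks) < x \<Longrightarrow> x < length ks \<Longrightarrow> \<not> unclosed (lo ks) k (length ks) x"
begin

lemma N_le: "N \<le> length ks"
  using grown by (simp add: grown_def)

lemma inj_end_props:
  assumes "a < length ks"
  shows "a \<le> inj_end ks a" "inj_end ks a < length ks" "lo ks (Suc (inj_end ks a)) \<le> a"
    "\<And>y. y \<le> length ks \<Longrightarrow> lo ks y \<le> a \<Longrightarrow> y \<le> Suc (inj_end ks a)"
proof -
  let ?B = "{b. indec ks a b}"
  have fin: "finite ?B" by (rule finite_subset[of _ "{..<length ks}"]) (auto simp: indec_def)
  have "lo ks (Suc a) \<le> a" using f_less[of "Suc a"] by simp
  then have a: "a \<in> ?B" using indec_lo[OF kup, of a "Suc a"] assms by simp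
  have "inj_end ks a \<in> ?B" unfolding inj_end_def using fin a by (intro Max_in) auto
  moreover show 1: "a \<le> inj_end ks a" unfolding inj_end_def using fin a by (rule Max_ge)
  ultimately show "inj_end ks a < length ks" "lo ks (Suc (inj_end ks a)) \<le> a"
    using indec_lo[OF kup, of a "Suc (inj_end ks a)"] by auto
  fix y assume y: "y \<le> length ks" "lo ks y \<le> a"
  show "y \<le> Suc (inj_end ks a)"
  proof (cases "a < y")
    case True
    then have "y - 1 \<in> ?B" using indec_lo[OF kup True] y by simp
    then have "y - 1 \<le> inj_end ks a" unfolding inj_end_def by (intro Max_ge fin)
    then show ?thesis by simp
  qed (use 1 in simp)
qed

lemma env_proj_iff:
  "a < length ks \<Longrightarrow> env_proj ks (Some (a, b)) \<longleftrightarrow> lo ks (Suc (inj_end ks a)) = a"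
  using inj_end_props(2)[of a] lo_psoc[of "inj_end ks a" ks] by auto

text \<open>A projective envelope is also the projective cover of its cokernel, so \<open>j\<close>
  syzygies lead back from the \<open>j\<close>-th cosyzygy to \<open>[f y, y)\<close>. The parity
  cases spell out this \<open>j\<close>-th syzygy.\<close>

lemma cosyz_origin:
  assumes "y \<le> length ks" "0 < y"
    and "\<And>i. i < j \<Longrightarrow> env_proj ks ((cosyz ks ^^ i) (Some (lo ks y, y - 1)))"
    and "(cosyz ks ^^ j) (Some (lo ks y, y - 1)) = Some (a, b)"
  shows "a \<le> b \<and> b < length ks \<and> lo ks (Suc b) \<le> a \<and>
    (if even j then (lo ks ^^ (j div 2)) a = lo ks y \<and> (lo ks ^^ (j div 2)) (Suc b) = y
     else (lo ks ^^ (j div 2)) a = y \<and> (lo ks ^^ Suc (j div 2)) (Suc b) = lo ks y)"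
  using assms(3,4)
proof (induction j arbitrary: a b)
  case 0
  then have "a = lo ks y" "b = y - 1" by simp_all
  then show ?case using assms(1,2) f_less[of y] by (simp, linarith)
next
  case (Suc j)
  obtain a0 b0 where s: "(cosyz ks ^^ j) (Some (lo ks y, y - 1)) = Some (a0, b0)"
  proof (cases "(cosyz ks ^^ j) (Some (lo ks y, y - 1))")
    case None
    have "cosyz ks None = Some (a, b)" using Suc.prems(2) unfolding funpow.simps comp_apply None .
    then show ?thesis by simp
  next
    case (Some p)
    then show ?thesis by (intro that[of "fst p" "snd p"]) (simp only: prod.collapse)
  qed
  have c: "cosyz ks (Some (a0, b0)) = Some (a, b)"
    using Suc.prems(2) unfolding funpow.simps comp_apply s .
  have ab: "b0 \<noteq> inj_end ks a0" "a = Suc b0" "b = inj_end ks a0"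
    using c by (auto split: if_splits)
  have H: "a0 \<le> b0 \<and> b0 < length ks \<and> lo ks (Suc b0) \<le> a0 \<and>
    (if even j then (lo ks ^^ (j div 2)) a0 = lo ks y \<and> (lo ks ^^ (j div 2)) (Suc b0) = y
     else (lo ks ^^ (j div 2)) a0 = y \<and> (lo ks ^^ Suc (j div 2)) (Suc b0) = lo ks y)"
    by (rule Suc.IH[OF _ s]) (rule Suc.prems(1), simp)
  note IH = H[THEN conjunct1] H[THEN conjunct2, THEN conjunct1]
    H[THEN conjunct2, THEN conjunct2, THEN conjunct1] H[THEN conjunct2, THEN conjunct2, THEN conjunct2]
  have a0: "a0 < length ks" using IH(1,2) by simp
  have "env_proj ks (Some (a0, b0))" using Suc.prems(1)[OF lessI] unfolding s .
  \<comment> \<open>Projectivity of the envelope \<open>[a0, Suc b)\<close> enters here.\<close>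
  then have e: "lo ks (Suc b) = a0" using env_proj_iff[OF a0] ab by simp
  have "Suc b0 \<le> Suc b" using inj_end_props(4)[OF a0, of "Suc b0"] IH(2,3) ab by simp
  then have "a \<le> b" using ab by simp
  moreover have "b < length ks" using inj_end_props(2)[OF a0] ab by simp
  moreover have "lo ks (Suc b) \<le> a" using e IH(1) ab by simp
  moreover have "if even (Suc j)
    then (lo ks ^^ (Suc j div 2)) a = lo ks y \<and> (lo ks ^^ (Suc j div 2)) (Suc b) = y
    else (lo ks ^^ (Suc j div 2)) a = y \<and> (lo ks ^^ Suc (Suc j div 2)) (Suc b) = lo ks y"
  proof -
    have F: "(lo ks ^^ Suc (j div 2)) (Suc b) = (lo ks ^^ (j div 2)) a0"
      using it_Suc[of "j div 2" "Suc b"] unfolding e .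
    show ?thesis
    proof (cases "even j")
      case True
      then have d: "Suc j div 2 = j div 2" by simp
      have "(lo ks ^^ (j div 2)) a = y \<and> (lo ks ^^ (j div 2)) a0 = lo ks y"
        using IH(4) True ab(2) by presburger
      then show ?thesis unfolding d F using True by presburger
    next
      case False
      then have d: "Suc j div 2 = Suc (j div 2)" by presburger
      have "(lo ks ^^ Suc (j div 2)) a = lo ks y \<and> (lo ks ^^ (j div 2)) a0 = y"
        using IH(4) False ab(2) by presburger
      then show ?thesis unfolding d F using False by presburger
    qed
  qed
  ultimately show ?case by blast
qed

lemma env_proj_cosyz:
  assumes "y \<le> length ks" "0 < y" "j < 2 * Suc k"
  shows "env_proj ks ((cosyz ks ^^ j) (Some (lo ks y, y - 1)))"
  using assms(3)
proof (induction j rule: less_induct)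
  case (less j)
  show ?case
  proof (cases "(cosyz ks ^^ j) (Some (lo ks y, y - 1))")
    case None
    then show ?thesis by simp
  next
    case (Some ab)
    then obtain a b where s: "(cosyz ks ^^ j) (Some (lo ks y, y - 1)) = Some (a, b)" by (cases ab) simp
    have env: "env_proj ks ((cosyz ks ^^ i) (Some (lo ks y, y - 1)))" if "i < j" for i
      by (rule less.IH[OF that less_trans[OF that less.prems]])
    note c = cosyz_origin[OF assms(1,2) env s]
    note * = c[THEN conjunct1] c[THEN conjunct2, THEN conjunct1]
      c[THEN conjunct2, THEN conjunct2, THEN conjunct1] c[THEN conjunct2, THEN conjunct2, THEN conjunct2]
    have "a \<in> lo ks ` {..length ks}"
    proof (rule cosyzygy_torsionless[OF grown closed])
      show "j div 2 \<le> k" using less.prems by simp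
      show "(lo ks ^^ (j div 2)) a = lo ks y \<and> (lo ks ^^ (j div 2)) (Suc b) = y \<or>
        (lo ks ^^ (j div 2)) a = y \<and> (lo ks ^^ Suc (j div 2)) (Suc b) = lo ks y"
        using *(4) by presburger
      show "a < Suc b" "Suc b \<le> length ks" "lo ks (Suc b) \<le> a" using *(1-3) by simp_all
    qed
    then obtain w where w: "w \<le> length ks" "lo ks w = a" by blast
    have a: "a < length ks" using *(1,2) by simp
    \<comment> \<open>The envelope ends at or beyond every \<open>w\<close> with
      \<open>f w = a\<close>, so by monotonicity \<open>f\<close> takes the value \<open>a\<close>
      at its end.\<close>
    have "w \<le> Suc (inj_end ks a)" using inj_end_props(4)[OF a w(1)] w(2) by simp
    then have "a \<le> lo ks (Suc (inj_end ks a))" using f_mono[of w "Suc (inj_end ks a)"] w(2) by simp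
    then have "lo ks (Suc (inj_end ks a)) = a" using inj_end_props(3)[OF a] by simp
    then show ?thesis unfolding s env_proj_iff[OF a] .
  qed
qed

text \<open>The top simple is not torsionless, so it is closed through a witness, whose only
  possible end is \<open>n\<close>. By \<open>pd_ge_even\<close> the simple itself has projective
  dimension at least \<open>2k + 2\<close>.\<close>

lemma top_simple:
  shows "(lo ks ^^ Suc k) (length ks - 1) < (lo ks ^^ Suc k) (length ks)"
    and "(lo ks ^^ Suc k) (length ks) < (lo ks ^^ k) (length ks - 1)"
proof -
  let ?n = "length ks"
  have n: "lo ks ?n < ?n - 1" "?n - 1 < ?n" using f_gap[of ?n] N2 N_le by auto
  obtain y where y: "y \<le> ?n" "?n - 1 < y" "(lo ks ^^ Suc k) (?n - 1) < (lo ks ^^ Suc k) y"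
    "(lo ks ^^ Suc k) y < (lo ks ^^ k) (?n - 1)"
    using closed_imp_split[OF grown n closed[OF n]] by blast
  then have "y = ?n" by simp
  then show "(lo ks ^^ Suc k) (?n - 1) < (lo ks ^^ Suc k) ?n"
    "(lo ks ^^ Suc k) ?n < (lo ks ^^ k) (?n - 1)" using y by simp_all
qed

lemma gldim_eq: "gldim ks = 2 * Suc k"
  unfolding gldim_def
proof (rule Max_eqI)
  let ?S = "{pd ks a b | a b. indec ks a b}"
  have "?S \<subseteq> (\<lambda>(a, b). pd ks a b) ` ({..<length ks} \<times> {..<length ks})"
    by (force simp: indec_def)
  then show "finite ?S" by (rule finite_subset) auto
  show "p \<le> 2 * Suc k" if pS: "p \<in> ?S" for p
  proof (rule ccontr)
    obtain a b where ab: "p = pd ks a b" "indec ks a b" using pS by blast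
    moreover assume "\<not> p \<le> 2 * Suc k"
    ultimately have p: "2 * Suc k + 1 \<le> pd ks a (Suc b - 1)" by simp
    have lt: "a < Suc b" using ab by (simp add: indec_def)
    have b: "Suc b \<le> length ks" "lo ks (Suc b) \<le> a" using indec_lo[OF kup lt] ab by auto
    have "(lo ks ^^ Suc (Suc k)) (Suc b) < (lo ks ^^ Suc k) a"
      "(lo ks ^^ Suc k) a < (lo ks ^^ Suc k) (Suc b)"
      using pd_ge_odd[OF kup lt b, of "Suc k"] p by blast+
    then show False using two_valued[OF grown b(1) b(2)] lt it_Suc[of "Suc k" "Suc b"] by linarith
  qed
  have n: "length ks - 1 < length ks" "lo ks (length ks) \<le> length ks - 1"
    using f_gap[of "length ks"] N2 N_le by auto
  have ge: "2 * Suc k \<le> pd ks (length ks - 1) (length ks - 1)"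
    using pd_ge_even[OF kup n(1) _ n(2), of k] top_simple by blast
  have ind: "indec ks (length ks - 1) (length ks - 1)" using indec_lo[OF kup n(1)] n by blast
  have "pd ks (length ks - 1) (length ks - 1) \<le> 2 * Suc k"
  proof (rule ccontr)
    assume "\<not> ?thesis"
    then have "2 * Suc k + 1 \<le> pd ks (length ks - 1) (length ks - 1)" by simp
    then have "(lo ks ^^ Suc (Suc k)) (length ks) < (lo ks ^^ Suc k) (length ks - 1)"
      "(lo ks ^^ Suc k) (length ks - 1) < (lo ks ^^ Suc k) (length ks)"
      using pd_ge_odd[OF kup n(1) _ n(2), of "Suc k"] by blast+
    then show False using two_valued[OF grown _ n(2)] n(1) it_Suc[of "Suc k" "length ks"] by fastforce
  qed
  with ge ind show "2 * Suc k \<in> ?S" by (auto intro!: exI[of _ "length ks - 1"])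
qed

lemma domdim_le:
  assumes "\<And>i j. i < length ks \<Longrightarrow> j \<le> 2 * Suc k \<Longrightarrow>
    env_proj ks ((cosyz ks ^^ j) (Some (psoc ks i, i)))"
  shows False
proof -
  let ?n = "length ks"
  let ?F = "\<lambda>i. lo ks ^^ i"
  \<comment> \<open>\<open>[Y (j + 1), Y j)\<close> is the j-th syzygy of the top simple module; coresolving the last of them
    leads back to an interval starting at the top simple, which is not torsionless.\<close>
  define Y where "Y i = ?F (i div 2) (if even i then ?n else ?n - 1)" for i
  have Y2: "lo ks (Y i) = Y (Suc (Suc i))" for i by (simp add: Y_def)
  define y where "y = ?F (Suc k) ?n"
  have y0: "0 < y" using top_simple(1) by (simp add: y_def)
  have yn: "y \<le> ?n" unfolding y_def by (rule it_le)
  \<comment> \<open>The last syzygy of the top simple is \<open>[f^(k+1) (n - 1), y)\<close>; by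
    \<open>two_valued\<close> at \<open>n\<close> it is the projective module
    \<open>[f y, y)\<close>.\<close>
  have fy: "lo ks y = ?F (Suc k) (?n - 1)"
  proof -
    have "lo ks ?n \<le> ?n - 1" "?n - 1 \<le> ?n" using f_gap[of ?n] N2 N_le by auto
    then have "?F (Suc k) (?n - 1) = ?F (Suc k) (lo ks ?n)"
      using two_valued[OF grown order_refl] top_simple(1) by fastforce
    then show ?thesis by (simp add: y_def funpow_swap1[symmetric])
  qed
  let ?P = "Some (lo ks y, y - 1)"
  have env: "env_proj ks ((cosyz ks ^^ j) ?P)" if "j \<le> 2 * Suc k" for j
    using assms[of "y - 1" j] lo_psoc[of "y - 1" ks] y0 yn that by simp
  \<comment> \<open>Envelopes might reach beyond the projective covers met while resolving the top
    simple, so only lower bounds for the endpoints are carried along.\<close>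
  have "\<exists>a b. (cosyz ks ^^ j) ?P = Some (a, b) \<and> Y (2 * Suc k + 1 - j) \<le> a \<and> Y (2 * Suc k - j) \<le> Suc b"
    if "j \<le> 2 * Suc k" for j
    using that
  proof (induction j)
    case 0
    have "Y (2 * Suc k + 1) = lo ks y" "Y (2 * Suc k) = y"
      unfolding fy unfolding Y_def y_def by (simp_all del: funpow.simps)
    then show ?case using y0 by simp
  next
    case (Suc j)
    then obtain a b where s: "(cosyz ks ^^ j) ?P = Some (a, b)"
      and Ya: "Y (2 * Suc k + 1 - j) \<le> a" and Yb: "Y (2 * Suc k - j) \<le> Suc b" by auto
    have env': "env_proj ks ((cosyz ks ^^ i) ?P)" if "i < j" for i
      using that Suc.prems by (intro env) linarith
    note c = cosyz_origin[OF yn y0 env' s]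
    note * = c[THEN conjunct1] c[THEN conjunct2, THEN conjunct1]
      c[THEN conjunct2, THEN conjunct2, THEN conjunct2]
    have a: "a < ?n" using *(1,2) by simp
    define g where "g = Suc (inj_end ks a)"
    have Yn: "Y i \<le> ?n" for i using it_le[of "i div 2" "if even i then ?n else ?n - 1"]
      by (auto simp: Y_def split: if_splits)
    have Yg: "Y (2 * Suc k - Suc j) \<le> g"
    proof -
      have "Suc (Suc (2 * Suc k - Suc j)) = 2 * Suc k + 1 - j" using Suc.prems by simp
      then have "lo ks (Y (2 * Suc k - Suc j)) \<le> a" using Y2 Ya by simp
      then show ?thesis using inj_end_props(4)[OF a Yn] g_def by simp
    qed
    \<comment> \<open>The coresolution does not stop early: if it did, iterating \<open>f\<close> on
      the bound \<open>Yg\<close> would contradict \<open>top_simple(2)\<close> or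
      \<open>f y < y\<close>.\<close>
    have "Suc b \<noteq> g"
    proof
      assume bg: "Suc b = g"
      show False
      proof (cases "even j")
        case True
        then obtain i where i: "j = 2 * i" by blast
        have ik: "i \<le> k" using i Suc.prems by simp
        have "2 * Suc k - Suc j = Suc (2 * (k - i))" using i ik by simp
        then have "?F (k - i) (?n - 1) \<le> g" using Yg by (simp add: Y_def)
        then have "?F i (?F (k - i) (?n - 1)) \<le> ?F i g" by (rule it_mono)
        moreover have "?F i (?F (k - i) (?n - 1)) = ?F k (?n - 1)"
          using it_split[of "k - i" k "?n - 1"] ik by simp
        moreover have "?F i g = y" using *(3) unfolding bg i by simp
        ultimately show False using top_simple(2) y_def by simp
      next
        case False
        then obtain i where i: "j = 2 * i + 1" by (elim oddE)
        have ik: "i \<le> k" using i Suc.prems by simp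
        have "2 * Suc k - Suc j = 2 * (k - i)" using i ik by simp
        then have "?F (k - i) ?n \<le> g" using Yg by (simp add: Y_def)
        then have "?F (Suc i) (?F (k - i) ?n) \<le> ?F (Suc i) g" by (rule it_mono)
        moreover have "?F (Suc i) (?F (k - i) ?n) = y"
          using it_split[of "k - i" "Suc k" ?n] ik y_def by (simp add: Suc_diff_le del: funpow.simps)
        moreover have "?F (Suc i) g = lo ks y" using *(3) unfolding bg i by (simp del: funpow.simps)
        ultimately show False using f_less[OF y0] by simp
      qed
    qed
    then have "(cosyz ks ^^ Suc j) ?P = Some (Suc b, inj_end ks a)" using s g_def by simp
    moreover have "2 * Suc k + 1 - Suc j = 2 * Suc k - j" by simp
    ultimately show ?case using Yg Yb g_def by (simp del: funpow.simps)
  qed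
  from this[of "2 * Suc k"] obtain a b where s: "(cosyz ks ^^ (2 * Suc k)) ?P = Some (a, b)"
    and Ya: "Y 1 \<le> a" by auto
  have "env_proj ks ((cosyz ks ^^ i) ?P)" if "i < 2 * Suc k" for i
    using that by (intro env) linarith
  note c = cosyz_origin[OF yn y0 this s]
  have a: "a < ?n" using c[THEN conjunct1] c[THEN conjunct2, THEN conjunct1] by simp
  \<comment> \<open>The start \<open>a\<close> must be \<open>n - 1\<close>, which exceeds every
    socle since \<open>f n + 2 \<le> n\<close>.\<close>
  have "lo ks (Suc (inj_end ks a)) = a" using env[of "2 * Suc k"] s env_proj_iff[OF a] by simp
  moreover have "lo ks (Suc (inj_end ks a)) \<le> lo ks ?n" using inj_end_props(2)[OF a] by (intro f_mono) simp
  moreover have "lo ks ?n + 2 \<le> ?n" using f_gap[of ?n] N2 N_le by simp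
  moreover have "Y 1 = ?n - 1" by (simp add: Y_def)
  ultimately show False using Ya by simp
qed

lemma domdim_eq: "domdim ks = enat (2 * Suc k)"
  unfolding domdim_def
proof (rule antisym)
  let ?Q = "\<lambda>l. \<forall>i < length ks. \<forall>j < l. env_proj ks ((cosyz ks ^^ j) (Some (psoc ks i, i)))"
  show "Sup {enat l | l. ?Q l} \<le> enat (2 * Suc k)"
  proof (rule Sup_least)
    fix x assume "x \<in> {enat l | l. ?Q l}"
    then obtain l where l: "x = enat l" "?Q l" by blast
    have "l \<le> 2 * Suc k"
    proof (rule ccontr)
      assume "\<not> l \<le> 2 * Suc k"
      then have "\<And>i j. i < length ks \<Longrightarrow> j \<le> 2 * Suc k \<Longrightarrow>
          env_proj ks ((cosyz ks ^^ j) (Some (psoc ks i, i)))"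
        using l(2) by simp
      then show False by (rule domdim_le)
    qed
    then show "x \<le> enat (2 * Suc k)" using l by simp
  qed
  have "?Q (2 * Suc k)"
  proof (intro allI impI)
    fix i j assume "i < length ks" "j < 2 * Suc k"
    then show "env_proj ks ((cosyz ks ^^ j) (Some (psoc ks i, i)))"
      using env_proj_cosyz[of "Suc i" j] lo_psoc[of i ks] by simp
  qed
  then show "enat (2 * Suc k) \<le> Sup {enat l | l. ?Q l}" by (intro Sup_upper) blast
qed

end

section \<open>One-point extensions and termination of the closure\<close>

lemma lo_append: "y \<le> length ks \<Longrightarrow> ks \<noteq> [] \<Longrightarrow> lo (ks @ zs) y = lo ks y"
  by (cases ks; cases y) (auto simp: lo_def psoc_def min_def nth_append nth_Cons')

lemma pd_append: "b < length ks \<Longrightarrow> pd (ks @ zs) a b = pd ks a b"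
proof (induction ks a b rule: pd.induct)
  case (1 ks a b)
  have p: "psoc (ks @ zs) b = psoc ks b" using 1(2) by (simp add: psoc_def nth_append)
  show ?case
  proof (cases "a \<le> psoc ks b \<or> b < a")
    case True
    then show ?thesis unfolding pd.simps[of "ks @ zs" a b] pd.simps[of ks a b] p by simp
  next
    case False
    then have "pd (ks @ zs) (psoc ks b) (a - 1) = pd ks (psoc ks b) (a - 1)"
      by (intro 1(1)) (use 1(2) in auto)
    then show ?thesis unfolding pd.simps[of "ks @ zs" a b] pd.simps[of ks a b] p using False by simp
  qed
qed

lemma funpow_agree:
  fixes f g :: "nat \<Rightarrow> nat"
  assumes "\<And>y. y \<le> n \<Longrightarrow> g y = f y" "\<And>y. f y \<le> y" "y \<le> n"
  shows "(g ^^ j) y = (f ^^ j) y \<and> (f ^^ j) y \<le> n"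
proof (induction j)
  case (Suc j)
  then have "g ((f ^^ j) y) = f ((f ^^ j) y)" using assms(1) by blast
  then show ?case using Suc le_trans[OF assms(2)] by simp
qed (use assms in simp)

lemma unclosed_agree:
  fixes f g :: "nat \<Rightarrow> nat"
  assumes "\<And>y. y \<le> n \<Longrightarrow> g y = f y" "\<And>y. f y \<le> y"
  shows "unclosed g k n x \<longleftrightarrow> unclosed f k n x"
proof -
  have it: "(g ^^ j) y = (f ^^ j) y" if "y \<le> n" for j y
    using funpow_agree[of n g f y j] assms that by blast
  show ?thesis
  proof (cases "x \<le> n")
    case True
    show ?thesis unfolding unclosed_def it[OF True] by (simp only: it cong: conj_cong imp_cong)
  qed (simp add: unclosed_def)
qed

lemma grown_agree:
  assumes "\<And>y. y \<le> n \<Longrightarrow> g y = f y" "\<And>y. f y \<le> y" "grown f k N n"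
  shows "grown g k N n"
proof -
  have "unclosed g k y x \<longleftrightarrow> unclosed f k y x" if "y < n" for y x
    using that assms by (intro unclosed_agree) auto
  then show ?thesis using assms unfolding grown_def by simp
qed

text \<open>The axioms evaluate the function only at arguments up to \<open>N\<close>, and iteration
  never leaves that range; they therefore survive all extensions.\<close>

lemma ascent_agree:
  assumes f: "ascent f N L k" and g: "kupisch_fun g" and fg: "\<And>y. y \<le> N \<Longrightarrow> g y = f y"
  shows "ascent g N L k"
proof -
  interpret f: ascent f N L k by (rule f)
  interpret g: kupisch_fun g by (rule g)
  have it: "(g ^^ j) y = (f ^^ j) y" if "y \<le> N" for j y
    using funpow_agree[of N g f y j] fg f.f_le that by blast
  have LN: "L \<le> N" using f.f_le[of N] f.fN by simp
  show ?thesis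
  proof
    show "2 \<le> N" by (rule f.N2)
    show "g N = L" "g (N - 1) = L" using fg f.fN f.fN1 by simp_all
    show "g (Suc y) \<le> Suc (g y)" if "y < N" for y using that f.step[OF that] fg by simp
    show "(g ^^ Suc k) (N - 2) = 0" using it[of "N - 2" "Suc k"] f.zero by (simp del: funpow.simps)
    show "(g ^^ Suc k) N \<le> 1" using it[of N "Suc k"] f.one by (simp del: funpow.simps)
    show "(g ^^ Suc j) (N - 2) \<noteq> (g ^^ Suc j) (N - 1)" if "0 < (g ^^ j) (N - 2)" for j
      using f.even_simple[of j] that it[of "N - 2"] it[of "N - 1"] by (metis diff_le_self)
    show "(g ^^ j) z = (g ^^ j) x"
      if "L \<le> z" "z < x" "x < w" "w \<le> N - 2" "(g ^^ Suc j) x = (g ^^ Suc j) w" for z x w j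
    proof -
      have *: "z \<le> N" "x \<le> N" "w \<le> N" using that by auto
      have "(f ^^ j) z = (f ^^ j) x"
        using that(5) unfolding it[OF *(2)] it[OF *(3)] by (rule f.odd_simples[OF that(1-4)])
      then show ?thesis using it[OF *(1)] it[OF *(2)] by simp
    qed
  qed
qed

text \<open>The new projective has socle \<open>a\<close>, the start of the cliff module. That
  \<open>a\<close> exceeds the previous socle gives the upper Kupisch bound, and
  \<open>a < length ks\<close> gives the lower one.\<close>

lemma ext_d_grown:
  assumes kup: "kupisch ks" and g: "grown (lo ks) k N (length ks)"
    and c: "cliff (2 * Suc k) ks \<noteq> None"
  shows "kupisch (ext_d (2 * Suc k) ks) \<and> (\<exists>l. ext_d (2 * Suc k) ks = ks @ [l]) \<and>
    grown (lo (ext_d (2 * Suc k) ks)) k N (Suc (length ks))"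
proof -
  interpret kupisch_fun "lo ks" by (rule kupisch_lo[OF kup])
  let ?n = "length ks"
  have ne: "ks \<noteq> []" using kup by (auto simp: kupisch_def)
  obtain a where a: "cliff (2 * Suc k) ks = Some (a, ?n - 1)" "lo ks ?n < a" "a < ?n"
    "unclosed (lo ks) k ?n a"
    "\<And>x. lo ks ?n < x \<Longrightarrow> x < a \<Longrightarrow> \<not> unclosed (lo ks) k ?n x"
    using cliff_Some[OF kup c] by blast
  define es where "es = ks @ [?n - a + 1]"
  have e: "ext_d (2 * Suc k) ks = es" using a(1) ne by (simp add: ext_d_def es_def)
  have lon: "lo ks ?n = ?n - ks ! (?n - 1)" using ne by (simp add: lo_def psoc_def)
  have "kupisch es"
    unfolding kupisch_def
  proof (intro conjI allI impI)
    show "es \<noteq> []" "es ! 0 = 1" using kup by (auto simp: es_def kupisch_def nth_append)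
    fix i assume i: "0 < i \<and> i < length es"
    show "2 \<le> es ! i" "es ! i \<le> es ! (i - 1) + 1"
    proof (atomize (full), cases "i < ?n")
      case True
      then have "i - 1 < ?n" by simp
      with True have "es ! i = ks ! i" "es ! (i - 1) = ks ! (i - 1)" by (simp_all add: es_def nth_append)
      moreover have "2 \<le> ks ! i \<and> ks ! i \<le> ks ! (i - 1) + 1"
        using kup i True unfolding kupisch_def by blast
      ultimately show "2 \<le> es ! i \<and> es ! i \<le> es ! (i - 1) + 1" by simp
    next
      case False
      then have "i = ?n" using i by (simp add: es_def)
      then have "es ! i = ?n - a + 1" "es ! (i - 1) = ks ! (?n - 1)"
        using ne by (simp_all add: es_def nth_append)
      then show "2 \<le> es ! i \<and> es ! i \<le> es ! (i - 1) + 1" using a(2,3) lon by linarith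
    qed
  qed
  moreover have "grown (lo es) k N (Suc ?n)"
  proof -
    have ag: "lo es y = lo ks y" if "y \<le> ?n" for y using lo_append[OF that ne] by (simp add: es_def)
    have top: "lo es (Suc ?n) = a" using a(3) by (simp add: lo_def psoc_def es_def)
    have gn: "grown (lo es) k N ?n" by (rule grown_agree[OF ag f_le g])
    have u: "unclosed (lo es) k ?n x \<longleftrightarrow> unclosed (lo ks) k ?n x" for x
      by (rule unclosed_agree[OF ag f_le])
    have top_step: "lo es ?n < lo es (Suc ?n) \<and> unclosed (lo es) k ?n (lo es (Suc ?n)) \<and>
        (\<forall>x. lo es ?n < x \<and> x < lo es (Suc ?n) \<longrightarrow> \<not> unclosed (lo es) k ?n x)"
      unfolding top u ag[OF order_refl] using a(2,4,5) by blast
    show ?thesis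
      unfolding grown_def
    proof (rule conjI, goal_cases)
      case 1
      show ?case using gn by (simp add: grown_def)
    next
      case 2
      show ?case
      proof (intro allI impI)
        fix y assume y: "N \<le> y \<and> y < Suc ?n"
        show "lo es y < lo es (Suc y) \<and> unclosed (lo es) k y (lo es (Suc y)) \<and>
          (\<forall>x. lo es y < x \<and> x < lo es (Suc y) \<longrightarrow> \<not> unclosed (lo es) k y x)"
        proof (cases "y = ?n")
          case True
          show ?thesis unfolding True by (rule top_step)
        next
          case False
          then have "N \<le> y \<and> y < ?n" using y by simp
          then show ?thesis using gn unfolding grown_def by blast
        qed
      qed
    qed
  qed
  ultimately show ?thesis unfolding e using es_def by blast
qed

lemma ext_d_stages:
  assumes "kupisch A" "\<And>s. s < t \<Longrightarrow> cliff (2 * Suc k) ((ext_d (2 * Suc k) ^^ s) A) \<noteq> None"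
  shows "kupisch ((ext_d (2 * Suc k) ^^ t) A) \<and>
    (\<exists>zs. (ext_d (2 * Suc k) ^^ t) A = A @ zs \<and> length zs = t) \<and>
    grown (lo ((ext_d (2 * Suc k) ^^ t) A)) k (length A) (length A + t)"
  using assms(2)
proof (induction t)
  case 0
  have "grown (lo A) k (length A) (length A)" by (auto simp: grown_def)
  then show ?case using assms(1) by simp
next
  case (Suc t)
  let ?E = "ext_d (2 * Suc k)"
  let ?S = "(?E ^^ t) A"
  have IH: "kupisch ?S \<and> (\<exists>zs. ?S = A @ zs \<and> length zs = t) \<and>
    grown (lo ?S) k (length A) (length A + t)"
    using Suc.prems by (intro Suc.IH) (meson less_SucI)
  then obtain zs where zs: "?S = A @ zs" "length zs = t" by blast
  then have len: "length ?S = length A + t" by simp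
  have "cliff (2 * Suc k) ?S \<noteq> None" using Suc.prems by blast
  with ext_d_grown[of ?S k "length A"] IH len
  have *: "kupisch (?E ?S)" "\<exists>l. ?E ?S = ?S @ [l]" "grown (lo (?E ?S)) k (length A) (Suc (length ?S))"
    by auto
  then obtain l where "?E ?S = A @ (zs @ [l])" using zs by auto
  then have "\<exists>zs. ?E ?S = A @ zs \<and> length zs = Suc t" using zs by (intro exI[of _ "zs @ [l]"]) simp
  then show ?case using * len by simp
qed

lemma closure_stops:
  assumes kup: "kupisch A"
  shows "\<exists>t. cliff (2 * Suc k) ((ext_d (2 * Suc k) ^^ t) A) = None"
proof (rule ccontr)
  define S where "S t = (ext_d (2 * Suc k) ^^ t) A" for t
  let ?N = "length A"
  assume "\<not> ?thesis"
  then have c: "cliff (2 * Suc k) (S t) \<noteq> None" for t by (simp add: S_def)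
  have st: "kupisch (S t)" "\<exists>zs. S t = A @ zs \<and> length zs = t" "grown (lo (S t)) k ?N (?N + t)" for t
    using ext_d_stages[OF kup, of t k] c unfolding S_def by blast+
  have len: "length (S t) = ?N + t" for t using st(2)[of t] by auto
  have "\<exists>l. S (Suc t) = S t @ [l]" for t
    using ext_d_grown[of "S t" k ?N] st c len by (simp add: S_def)
  then have suc: "lo (S (Suc t)) y = lo (S t) y" if "y \<le> ?N + t" for t y
    using lo_append[of y "S t"] len[of t] that st(1)[of t] by (metis kupisch_def)
  have ag: "lo (S u) y = lo (S t) y" if "t \<le> u" "y \<le> ?N + t" for t u y
    using that by (induction u rule: dec_induct) (auto simp: suc)
  \<comment> \<open>Limit of the infinitely many stages: the value at \<open>y\<close> is already
    final at stage \<open>y\<close>.\<close>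
  define f where "f y = lo (S y) y" for y
  have f: "f y = lo (S t) y" if "y \<le> t" for t y using ag[of y t y] that by (simp add: f_def)
  show False
  proof (rule growth_stops[of f ?N k])
    show "f y + 2 \<le> y" if "2 \<le> y" for y
      using kupisch_fun.f_gap[OF kupisch_lo[OF st(1)] that] by (simp add: f_def)
    fix y assume y: "?N \<le> y"
    have g: "lo (S (Suc y)) y < lo (S (Suc y)) (Suc y)"
      "unclosed (lo (S (Suc y))) k y (lo (S (Suc y)) (Suc y))"
      using st(3)[of "Suc y"] y by (auto simp: grown_def)
    show "f y < f (Suc y)" using g f[of y "Suc y"] f[of "Suc y" "Suc y"] by simp
    have "unclosed f k y (f (Suc y)) \<longleftrightarrow> unclosed (lo (S (Suc y))) k y (f (Suc y))"
    proof (rule unclosed_agree)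
      show "f x = lo (S (Suc y)) x" if "x \<le> y" for x using f[of x "Suc y"] that by linarith
    qed (rule kupisch_fun.f_le[OF kupisch_lo[OF st(1)]])
    then show "unclosed f k y (f (Suc y))" using g f[of "Suc y" "Suc y"] by simp
  qed
qed

section \<open>The characteristic sequence of the ascent algebra as conditions on iterates\<close>

context
  fixes ks :: "nat list"
  assumes kup: "kupisch ks"
begin

interpretation kupisch_fun "lo ks"
  by (rule kupisch_lo[OF kup])

text \<open>Dimension \<open>2j + 1\<close> means that the iterates of the endpoints first coincide
  at exponent \<open>j + 1\<close>.\<close>

lemma pd_odd:
  assumes "x < y" "y \<le> length ks" "lo ks y \<le> x" "pd ks x (y - 1) = 2 * j + 1"
  shows "(lo ks ^^ Suc j) x = (lo ks ^^ Suc j) y" "(lo ks ^^ j) x < (lo ks ^^ j) y"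
proof -
  have o: "(lo ks ^^ Suc j) y < (lo ks ^^ j) x \<and> (lo ks ^^ j) x < (lo ks ^^ j) y"
    using pd_ge_odd[OF kup assms(1-3), of j] assms(4) by simp
  then show "(lo ks ^^ j) x < (lo ks ^^ j) y" by blast
  have "\<not> (lo ks ^^ Suc j) x < (lo ks ^^ Suc j) y"
    using pd_ge_even[OF kup assms(1-3), of j] assms(4) o by simp
  then show "(lo ks ^^ Suc j) x = (lo ks ^^ Suc j) y"
    using it_mono[of x y "Suc j"] assms(1) by linarith
qed

text \<open>If the endpoints first merge at exponent \<open>i + 1\<close> while
  \<open>f^i x > 0\<close>, then syzygy \<open>2i + 1\<close> is non-zero and the next one vanishes,
  an odd dimension.\<close>

lemma pd_even:
  assumes "x < y" "y \<le> length ks" "lo ks y \<le> x" "even (pd ks x (y - 1))" "0 < (lo ks ^^ j) x"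
  shows "(lo ks ^^ Suc j) x \<noteq> (lo ks ^^ Suc j) y"
proof
  let ?P = "\<lambda>i. (lo ks ^^ Suc i) x = (lo ks ^^ Suc i) y"
  assume P: "?P j"
  define i where "i = (LEAST i. ?P i)"
  have i: "?P i" unfolding i_def using P by (rule LeastI)
  have ij: "i \<le> j" unfolding i_def using P by (rule Least_le)
  have pos: "0 < (lo ks ^^ i) x" using it_antimono[OF ij, of x] assms(5) by linarith
  have "(lo ks ^^ i) x \<noteq> (lo ks ^^ i) y"
  proof (cases i)
    case 0 then show ?thesis using assms(1) by simp
  next
    case (Suc l)
    then show ?thesis using not_less_Least[of l ?P] unfolding i_def[symmetric] by simp
  qed
  then have lt: "(lo ks ^^ i) x < (lo ks ^^ i) y" using it_mono[of x y i] assms(1) by linarith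
  have "(lo ks ^^ Suc i) y < (lo ks ^^ i) x" using i f_less[OF pos] by simp
  then have "2 * i + 1 \<le> pd ks x (y - 1)" using pd_ge_odd[OF kup assms(1-3), of i] lt by simp
  moreover have "\<not> 2 * Suc i \<le> pd ks x (y - 1)" using pd_ge_even[OF kup assms(1-3), of i] i by simp
  ultimately have "pd ks x (y - 1) = 2 * i + 1" by simp
  then show False using assms(4) by simp
qed

end

lemma constant_run:
  fixes F :: "nat \<Rightarrow> 'a"
  assumes "\<And>i. a \<le> i \<Longrightarrow> i < b \<Longrightarrow> F (Suc i) = F i" "a \<le> b"
  shows "F b = F a"
  using assms(2,1) by (induction b rule: dec_induct) auto

locale ascending_char =
  fixes A :: "nat list" and cs :: "nat list" and k N L :: nat
  assumes kup: "kupisch A" and asc: "ascending A"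
    and char: "charseq A (proj A (omega A)) = cs @ [0, 1]"
    and sorted: "sorted_wrt (<) cs"
    and odd: "c \<in> set cs \<Longrightarrow> odd c" and bound: "c \<in> set cs \<Longrightarrow> c \<le> 2 * Suc k"
    and N: "N = length A" and L: "L = lo A N"
begin

sublocale kupisch_fun "lo A"
  by (rule kupisch_lo[OF kup])

lemma char_nth:
  shows "L + (length cs + 2) = N"
    and "i < length cs + 2 \<Longrightarrow> (cs @ [0, 1]) ! i = (if odd (pd A (L + i) (L + i)) then pd A (L + i) (L + i) else 0)"
proof -
  have N0: "0 < N" using kup N by (simp add: kupisch_def)
  have LN: "L < N" using f_less[OF N0] L by simp
  have p: "pd A L (N - 1) = 0" using pd_rec[of L N A] LN N L by simp
  have "psoc A (omega A) = L" using L N N0 by (simp add: omega_def lo_def)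
  then have "cs @ [0, 1] = map (\<lambda>i. if odd (pd A i i) then pd A i i else pd A L (N - 1)) [L..<N]"
    using char N N0 by (simp add: proj_def omega_def del: upt_Suc cong: if_cong)
  note c = this[unfolded p]
  from arg_cong[OF c, of length] have "length (cs @ [0, 1]) = N - L" by simp
  then show 1: "L + (length cs + 2) = N" using LN by simp
  show "(cs @ [0, 1]) ! i = (if odd (pd A (L + i) (L + i)) then pd A (L + i) (L + i) else 0)"
    if "i < length cs + 2" unfolding c using that 1 by (subst nth_map) auto
qed

lemma pd_cs: "i < length cs \<Longrightarrow> pd A (L + i) (L + i) = cs ! i"
  using char_nth(2)[of i] odd[OF nth_mem, of i]
  by (cases "odd (pd A (L + i) (L + i))") (simp_all add: nth_append)

lemma pd_N2: "even (pd A (N - 2) (N - 2))"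
proof -
  have "L + length cs = N - 2" using char_nth(1) by simp
  then show ?thesis using char_nth(2)[of "length cs"] by (auto split: if_splits elim: oddE)
qed

lemma pd_N1: "pd A (N - 1) (N - 1) = 1"
proof -
  have "L + Suc (length cs) = N - 1" using char_nth(1) by simp
  then show ?thesis using char_nth(2)[of "Suc (length cs)"] by (auto simp: nth_append split: if_splits)
qed

lemma simple_merge:
  assumes "z < length cs" "cs ! z = 2 * e + 1"
  shows "(lo A ^^ Suc e) (L + z) = (lo A ^^ Suc e) (Suc (L + z))"
    "(lo A ^^ e) (L + z) < (lo A ^^ e) (Suc (L + z))"
proof -
  have 1: "L + z < Suc (L + z)" "Suc (L + z) \<le> length A" using assms(1) char_nth(1) N by simp_all
  have 2: "lo A (Suc (L + z)) \<le> L + z" using f_less[of "Suc (L + z)"] by simp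
  have "pd A (L + z) (Suc (L + z) - 1) = 2 * e + 1" using pd_cs[OF assms(1)] assms(2) by simp
  from pd_odd[OF kup 1 2 this]
  show "(lo A ^^ Suc e) (L + z) = (lo A ^^ Suc e) (Suc (L + z))"
    "(lo A ^^ e) (L + z) < (lo A ^^ e) (Suc (L + z))" .
qed

lemma cs_odd: "z < length cs \<Longrightarrow> \<exists>e. cs ! z = 2 * e + 1"
  using odd[of "cs ! z"] by (auto elim: oddE)

text \<open>The top simple has dimension 1, so its syzygy \<open>[L, N - 1)\<close> is
  projective.\<close>

lemma lo_N1: "lo A (N - 1) = L"
proof -
  have 1: "N - 1 < N" "N \<le> length A" using char_nth(1) N by simp_all
  have 2: "lo A N \<le> N - 1" using f_less[of N] 1 by simp
  have "lo A N < N - 1" using pd_ge_odd[OF kup 1 2, of 0] pd_N1 by simp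
  moreover have "\<not> 2 \<le> pd A (N - 1) (N - 1)" using pd_N1 by simp
  ultimately have "\<not> lo A (N - 1) < lo A N" using pd_ge_even[OF kup 1 2, of 0] by simp
  then show ?thesis using f_mono[of "N - 1" N] L by simp
qed

lemma step:
  assumes "y < N"
  shows "lo A (Suc y) \<le> Suc (lo A y)"
proof (cases y)
  case 0 then show ?thesis using f_1 by simp
next
  case (Suc p)
  have p: "p < length A" "Suc p < length A" using assms Suc N by simp_all
  then have "A ! p \<le> A ! Suc p" using asc unfolding ascending_def by simp
  then show ?thesis using Suc lo_psoc[OF p(1)] lo_psoc[OF p(2)] kupisch_bounds[OF kup p(1)]
    by (simp add: psoc_def)
qed

lemma it_step: "y < N \<Longrightarrow> (lo A ^^ j) (Suc y) \<le> Suc ((lo A ^^ j) y)"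
proof (induction j)
  case (Suc j)
  have "(lo A ^^ j) y < N" using it_le[of j y] Suc.prems by linarith
  then have "lo A (Suc ((lo A ^^ j) y)) \<le> Suc (lo A ((lo A ^^ j) y))" by (rule step)
  then show ?case using f_mono[OF Suc.IH[OF Suc.prems]] by simp
qed simp

text \<open>The bound on the \<open>c_i\<close> makes \<open>f^(k+1)\<close> constant on
  \<open>[L, N - 2]\<close>. So \<open>y = f^(k+1) (N - 1)\<close> exceeds \<open>f y\<close> by at
  most 1, and \<open>f_gap\<close> leaves only \<open>y \<le> 1\<close>.\<close>

lemma top_iterates:
  shows "(lo A ^^ Suc k) (N - 2) = 0" "(lo A ^^ Suc k) N \<le> 1"
proof -
  have eq: "(lo A ^^ Suc k) (N - 2) = (lo A ^^ Suc k) L"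
  proof (rule constant_run[where F = "lo A ^^ Suc k"])
    show "L \<le> N - 2" using char_nth(1) by simp
    fix i assume i: "L \<le> i" "i < N - 2"
    define z where "z = i - L"
    have z: "z < length cs" "i = L + z" using i char_nth(1) by (simp_all add: z_def)
    obtain e where e: "cs ! z = 2 * e + 1" using cs_odd z by blast
    have "Suc e \<le> Suc k" using e bound[OF nth_mem[OF z(1)]] by simp
    from it_merge[OF simple_merge(1)[OF z(1) e] this]
    show "(lo A ^^ Suc k) (Suc i) = (lo A ^^ Suc k) i" unfolding z(2) by (rule sym)
  qed
  define y where "y = (lo A ^^ Suc k) (N - 1)"
  have fy: "lo A y = (lo A ^^ Suc k) (N - 2)"
    unfolding y_def eq by (simp only: funpow_swap1 lo_N1)
  have e: "Suc (N - 2) = N - 1" and lt: "N - 2 < N" using char_nth(1) by simp_all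
  have "y \<le> Suc (lo A y)" using it_step[OF lt, of "Suc k"] unfolding fy unfolding y_def e .
  then have y1: "y \<le> 1" using f_gap[of y] by linarith
  then have "lo A y = 0" using f_0 f_1 by (cases y) simp_all
  then show "(lo A ^^ Suc k) (N - 2) = 0" using fy by simp
  have "(lo A ^^ Suc k) N = y" unfolding y_def it_Suc lo_N1 L[symmetric] ..
  then show "(lo A ^^ Suc k) N \<le> 1" using y1 by simp
qed

lemma ascent: "ascent (lo A) N L k"
proof
  show "2 \<le> N" using char_nth(1) by simp
  show "lo A N = L" using L by simp
  show "lo A (N - 1) = L" by (rule lo_N1)
  show "lo A (Suc y) \<le> Suc (lo A y)" if "y < N" for y using that by (rule step)
  show "(lo A ^^ Suc k) (N - 2) = 0" "(lo A ^^ Suc k) N \<le> 1" by (rule top_iterates)+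
  show "(lo A ^^ Suc j) (N - 2) \<noteq> (lo A ^^ Suc j) (N - 1)" if "0 < (lo A ^^ j) (N - 2)" for j
  proof (rule pd_even[OF kup _ _ _ _ that])
    show "N - 2 < N - 1" "N - 1 \<le> length A" "lo A (N - 1) \<le> N - 2"
      using char_nth(1) N lo_N1 by simp_all
    have "N - 1 - 1 = N - 2" by simp
    then show "even (pd A (N - 2) (N - 1 - 1))" using pd_N2 by (simp only:)
  qed
  show "(lo A ^^ j) z = (lo A ^^ j) x"
    if *: "L \<le> z" "z < x" "x < w" "w \<le> N - 2" "(lo A ^^ Suc j) x = (lo A ^^ Suc j) w" for z x w j
  proof -
    define q where "q = x - L"
    have q: "q < length cs" "x = L + q" using * char_nth(1) by (simp_all add: q_def)
    obtain e where e: "cs ! q = 2 * e + 1" using cs_odd q by blast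
    have xw: "x \<le> Suc x" "Suc x \<le> w" using *(3) by simp_all
    have m: "(lo A ^^ Suc j) x = (lo A ^^ Suc j) (Suc x)"
      using it_mono[OF xw(1), of "Suc j"] it_mono[OF xw(2), of "Suc j"] *(5) by linarith
    \<comment> \<open>\<open>x\<close> and \<open>Suc x\<close> first merge at exponent
      \<open>e + 1\<close>. Earlier entries of \<open>cs\<close> are smaller, so their neighbours
      have merged by exponent \<open>j\<close>.\<close>
    have ej: "e \<le> j"
    proof (rule ccontr)
      assume "\<not> e \<le> j"
      then have "Suc j \<le> e" by simp
      from it_merge[OF m this] show False using simple_merge(2)[OF q(1) e] unfolding q(2) by simp
    qed
    have "(lo A ^^ j) x = (lo A ^^ j) z"
    proof (rule constant_run[where F = "lo A ^^ j"])
      show "z \<le> x" using * by simp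
      fix i assume i: "z \<le> i" "i < x"
      define p where "p = i - L"
      have p: "p < q" "i = L + p" using i * q by (simp_all add: p_def)
      then have pl: "p < length cs" using q by simp
      obtain e' where e': "cs ! p = 2 * e' + 1" using cs_odd pl by blast
      have "cs ! p < cs ! q" using sorted_wrt_nth_less[OF sorted p(1) q(1)] .
      then have "Suc e' \<le> j" using e e' ej by simp
      from it_merge[OF simple_merge(1)[OF pl e'] this]
      show "(lo A ^^ j) (Suc i) = (lo A ^^ j) i" unfolding p(2) by (rule sym)
    qed
    then show ?thesis by simp
  qed
qed

end

section \<open>Concavity, the first summit and its second radical\<close>

theorem theorem2:
  fixes d :: nat and cs :: "nat list" and A :: "nat list"
  assumes "even d" and "0 < d"
    and "sorted_wrt (<) cs"
    and "\<forall>c \<in> set cs. odd c \<and> 0 < c \<and> c \<le> d"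
    and "kupisch A" and "ascending A"
    and "charseq A (proj A (omega A)) = cs @ [0, 1]"
  shows "closure_terminates d A \<and>
    (let H = partial_closure d A in
       kupisch H \<and> concave H \<and> higher_auslander H \<and> gldim H = d \<and>
       (\<exists>b. (\<forall>b'. first_summit H b' \<longleftrightarrow> b' = b) \<and>
            charseq H (radpow 2 (proj H b)) = cs))"
proof -
  obtain k where d: "d = 2 * Suc k"
    using assms(1,2) by (metis dvdE gr0_implies_Suc nat_0_less_mult_iff)
  define N where "N = length A"
  define L where "L = lo A N"
  interpret A: ascending_char A cs k N L
    by standard (use assms d N_def L_def in auto)
  define t where "t = (LEAST t. cliff d ((ext_d d ^^ t) A) = None)"
  define H where "H = (ext_d d ^^ t) A"
  have ex: "\<exists>t. cliff d ((ext_d d ^^ t) A) = None" unfolding d by (rule closure_stops[OF A.kup])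
  then have cH: "cliff d H = None" unfolding H_def t_def by (rule LeastI_ex)
  have "cliff d ((ext_d d ^^ s) A) \<noteq> None" if "s < t" for s
    using not_less_Least that unfolding t_def by blast
  from ext_d_stages[OF A.kup, of t k, folded d, OF this]
  obtain zs where kH: "kupisch H" and H: "H = A @ zs" and gH: "grown (lo H) k N (length H)"
    unfolding H_def[symmetric] N_def by auto
  have A_ne: "A \<noteq> []" using A.kup by (simp add: kupisch_def)
  have loA: "lo H y = lo A y" if "y \<le> N" for y using lo_append[of y A zs] that A_ne H N_def by simp
  interpret H: closed_algebra H N L k
  proof (intro closed_algebra.intro closed_algebra_axioms.intro kH gH)
    show "ascent (lo H) N L k"
      by (rule ascent_agree[OF A.ascent kupisch_lo[OF kH] loA])
    show "\<not> unclosed (lo H) k (length H) x" if "lo H (length H) < x" "x < length H" for x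
      using cH that unfolding d cliff_None[OF kH] by blast
  qed
  have N2: "L + length cs + 2 = N" using A.char_nth(1) by simp
  have NH: "N \<le> length H" by (rule H.N_le)
  have nthH: "H ! b = Suc b - lo H (Suc b)" "lo H (Suc b) \<le> b" "lo H (Suc b) = psoc H b" if "b < length H" for b
    using lo_psoc[OF that] kupisch_bounds[OF kH that] by (simp_all add: psoc_def, linarith)
  have incr: "lo H y < lo H (Suc y)" if "N \<le> y" "y < length H" for y
    using gH that by (simp add: grown_def)
  have up: "H ! i \<le> H ! j" if "i \<le> j" "j \<le> N - 1" for i j
  proof -
    have "j < length A" using that N2 N_def by simp
    then show ?thesis using A.asc that H unfolding ascending_def by (simp add: nth_append)
  qed
  have down: "H ! j \<le> H ! i" if "N - 1 \<le> i" "i \<le> j" "j < length H" for i j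
    using that(2,3)
  proof (induction j rule: dec_induct)
    case (step j)
    have "lo H (Suc j) < lo H (Suc (Suc j))" using incr[of "Suc j"] step that(1) N2 by simp
    then have "H ! Suc j \<le> H ! j" using nthH[of j] nthH[of "Suc j"] step by simp
    then show ?case using step by simp
  qed simp
  have "concave H"
    unfolding concave_def by (rule exI[of _ "N - 1"]) (use up down NH N2 in auto)
  have N1H: "N - 1 < length H" using NH N2 by simp
  have height: "height H = H ! (N - 1)"
    unfolding height_def
  proof (rule Max_eqI)
    show "H ! (N - 1) \<in> set H" using N1H by simp
    fix h assume "h \<in> set H"
    then obtain i where "i < length H" "h = H ! i" by (auto simp: in_set_conv_nth)
    then show "h \<le> H ! (N - 1)" using up[of i "N - 1"] down[of "N - 1" i] by (cases "i \<le> N - 1") auto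
  qed simp
  \<comment> \<open>\<open>f (N - 1) = f N\<close> makes the radical at index \<open>N - 1\<close>
    projective. Later radicals are not projective because \<open>f\<close> grows strictly, and
    earlier projectives are shorter.\<close>
  have summit: "first_summit H b \<longleftrightarrow> b = N - 1" for b
  proof
    assume b: "b = N - 1"
    have p: "psoc H b = L" "psoc H (N - 2) = L"
    proof -
      have "Suc b = N" "Suc (N - 2) = N - 1" using b N2 by simp_all
      then show "psoc H b = L" "psoc H (N - 2) = L"
        using nthH(3)[of b] nthH(3)[of "N - 2"] H.fN H.fN1 b N1H by simp_all
    qed
    then have "radpow 1 (proj H b) = proj H (N - 2)"
      using b N2 by (simp add: proj_def numeral_2_eq_2)
    then show "first_summit H b" using b N1H height unfolding first_summit_def
      by (intro conjI exI[of _ "N - 2"]) auto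
  next
    assume fs: "first_summit H b"
    then obtain c where b: "b < length H" "H ! b = height H"
      and c: "radpow 1 (proj H b) = proj H c"
      unfolding first_summit_def by blast
    have *: "psoc H b = psoc H (b - 1)" "1 \<le> b"
      using c by (auto simp: proj_def split: if_splits)
    have eq: "lo H b = lo H (Suc b)" using * nthH(3)[of b] nthH(3)[of "b - 1"] b by simp
    show "b = N - 1"
    proof (rule ccontr)
      assume "b \<noteq> N - 1"
      then consider "N \<le> b" | "b \<le> N - 2" by linarith
      then show False
      proof cases
        case 1
        then show False using incr[of b] eq b by simp
      next
        case 2
        have "Suc (N - 1) = N" "Suc (N - 2) = N - 1" using N2 by simp_all
        then have "H ! (N - 2) < H ! (N - 1)"
          using nthH(1)[of "N - 2"] nthH(1,2)[of "N - 1"] N1H H.fN H.fN1 N2 by (simp, arith)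
        moreover have "H ! b \<le> H ! (N - 2)" using 2 by (intro up) simp_all
        ultimately show False using b height by simp
      qed
    qed
  qed
  have "charseq H (radpow 2 (proj H (N - 1))) = cs"
  proof -
    have "psoc H (N - 1) = L" using nthH(3)[OF N1H] H.fN N2 by simp
    then have pr: "proj H (N - 1) = Some (L, N - 1)" by (simp add: proj_def)
    show ?thesis
    proof (cases cs)
      case Nil
      \<comment> \<open>Here \<open>N = L + 2\<close>, so the summit has length 2 and its second
        radical is zero.\<close>
      then show ?thesis unfolding pr using N2 by simp
    next
      case (Cons c cs')
      then have "0 < length cs" by simp
      then have r: "Suc (N - 1 - 2) = L + length cs" using N2 by linarith
      have "radpow 2 (proj H (N - 1)) = Some (L, N - 1 - 2)" unfolding pr using N2 Cons by simp
      then have "charseq H (radpow 2 (proj H (N - 1))) =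
        map (\<lambda>i. if odd (pd H i i) then pd H i i else pd H L (N - 1 - 2)) [L..<Suc (N - 1 - 2)]"
        by simp
      also have "\<dots> = cs"
      proof (rule nth_equalityI)
        show len: "length (map (\<lambda>i. if odd (pd H i i) then pd H i i else pd H L (N - 1 - 2))
          [L..<Suc (N - 1 - 2)]) = length cs"
          unfolding r by simp
        fix i assume "i < length (map (\<lambda>i. if odd (pd H i i) then pd H i i else pd H L (N - 1 - 2))
          [L..<Suc (N - 1 - 2)])"
        then have i: "i < length cs" unfolding len .
        \<comment> \<open>The composition factors of the second radical are simples of
          \<open>A\<close>, whose dimensions are not changed by the extensions.\<close>
        have "pd H (L + i) (L + i) = cs ! i"
          using pd_append[of "L + i" A zs "L + i"] A.pd_cs[OF i] H i N2 N_def by simp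
        moreover have "odd (cs ! i)" using A.odd i by simp
        ultimately show "map (\<lambda>i. if odd (pd H i i) then pd H i i else pd H L (N - 1 - 2))
          [L..<Suc (N - 1 - 2)] ! i = cs ! i"
          unfolding r using i by simp
      qed
      finally show ?thesis .
    qed
  qed
  moreover have "higher_auslander H" "gldim H = d"
    using H.gldim_eq H.domdim_eq d by (simp_all add: higher_auslander_def)
  moreover have pc: "partial_closure d A = H" by (simp add: partial_closure_def H_def t_def)
  moreover have "closure_terminates d A" using ex by (simp add: closure_terminates_def)
  ultimately show ?thesis
    unfolding Let_def pc using kH \<open>concave H\<close> summit by (intro conjI exI[of _ "N - 1"] allI)
qed

end
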